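(* Let $0<b<1$ and let $C_{-b}$ be the Chebyshev's method of $p_{-b}(z)=(z^2-1)(z^2+b)$. The immediate basins $\mathcal A_{i\sqrt b}$ and $\mathcal A_{-i\sqrt b}$ are simply connected. If there is a non-zero pole of $C_{-b}$ on the boundary of any of these two immediate basins, then the Julia set of $C_{-b}$ is connected.
   Context: For a polynomial $p$, the Chebyshev's method of $p$ is the rational map $C_p(z)=z-\left[1+\frac12 L_p(z)\right]\frac{p(z)}{p'(z)}$ with $L_p(z)=\frac{p(z)p''(z)}{(p'(z))^2}$, regarded as a self-map of the Riemann sphere $\widehat{\mathbb C}$. Write $C_{-b}:=C_{p_{-b}}$. The roots $\pm1,\pm i\sqrt b$ of $p_{-b}$ are superattracting fixed points of $C_{-b}$; for such a root $\zeta$, $\mathcal A_\zeta$ denotes its immediate basin, i.e. the Fatou component of $C_{-b}$ containing $\zeta$. The poles of $C_{-b}$ (points of $\mathbb C$ mapped to $\infty$) are $0$ and $\pm\sqrt{(1-b)/2}$; the non-zero poles are $\pm\sqrt{(1-b)/2}$. The Julia set is the complement in $\widehat{\mathbb C}$ of the Fatou set (the set of normality of $\{C_{-b}^n\}_{n>0}$). *)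

theory Defs
  imports
    "HOL-Complex_Analysis.Complex_Analysis"
    "HOL-Computational_Algebra.Polynomial_Factorial"
    "HOL-Computational_Algebra.Field_as_Ring"
begin

datatype riemann_sphere = Fin complex | Infty

text \<open>
  Inverse stereographic projection onto the unit sphere of $\mathbb{C} \times \mathbb{R}$ from the
  north pole. Its distance (the chordal metric) is the metric of the Riemann sphere:
  $2|z-w| / \sqrt{(1+|z|^2)(1+|w|^2)}$ between finite points and $2 / \sqrt{1+|z|^2}$
  between $z$ and $\infty$.
\<close>

fun to_unit_sphere :: "riemann_sphere \<Rightarrow> complex \<times> real" where
  "to_unit_sphere (Fin z) =
     (2 * z / of_real (1 + (cmod z)\<^sup>2), ((cmod z)\<^sup>2 - 1) / ((cmod z)\<^sup>2 + 1))"
| "to_unit_sphere Infty = (0, 1)"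

lemma inj_to_unit_sphere: "inj to_unit_sphere"
proof -
  have height: "((cmod z)\<^sup>2 - 1) / ((cmod z)\<^sup>2 + 1) = 1 - 2 / (1 + (cmod z)\<^sup>2)" for z :: complex
  proof -
    have "1 + (cmod z)\<^sup>2 \<noteq> 0"
      using zero_le_power2[of "cmod z"] by linarith
    then show ?thesis
      by (simp add: field_simps)
  qed
  have pos: "1 + (cmod z)\<^sup>2 > 0" for z :: complex
    using zero_le_power2[of "cmod z"] by linarith
  have fin_fin: "z = w" if "to_unit_sphere (Fin z) = to_unit_sphere (Fin w)" for z w
  proof -
    have "1 + (cmod z)\<^sup>2 = 1 + (cmod w)\<^sup>2"
      using that pos[of z] pos[of w] by (simp add: height field_simps)
    moreover have "(of_real (1 + (cmod w)\<^sup>2) :: complex) \<noteq> 0"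
      using pos[of w] by (metis less_irrefl of_real_eq_0_iff)
    ultimately show ?thesis
      using that by (simp del: of_real_add of_real_power)
  qed
  have fin_inf: "to_unit_sphere (Fin z) \<noteq> to_unit_sphere Infty" for z
    using pos[of z] by (simp add: height)
  show ?thesis
  proof (rule injI)
    fix x y assume "to_unit_sphere x = to_unit_sphere y"
    then show "x = y"
      using fin_fin fin_inf by (cases x; cases y) (auto simp del: to_unit_sphere.simps dest: sym)
  qed
qed

instantiation riemann_sphere :: metric_space
begin

definition dist_riemann_sphere :: "riemann_sphere \<Rightarrow> riemann_sphere \<Rightarrow> real" where
  "dist_riemann_sphere x y = dist (to_unit_sphere x) (to_unit_sphere y)"

definition uniformity_riemann_sphere :: "(riemann_sphere \<times> riemann_sphere) filter" where
  "uniformity_riemann_sphere = (INF e\<in>{0<..}. principal {(x, y). dist x y < e})"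

definition open_riemann_sphere :: "riemann_sphere set \<Rightarrow> bool" where
  "open_riemann_sphere U \<longleftrightarrow> (\<forall>x\<in>U. \<forall>\<^sub>F (x', y) in uniformity. x' = x \<longrightarrow> y \<in> U)"

instance
proof
  fix x y z :: riemann_sphere
  show "dist x y = 0 \<longleftrightarrow> x = y"
    using inj_to_unit_sphere by (auto simp: dist_riemann_sphere_def dest: injD)
  show "dist x y \<le> dist x z + dist y z"
    by (simp add: dist_riemann_sphere_def dist_triangle2)
qed (simp_all add: uniformity_riemann_sphere_def open_riemann_sphere_def)

end

text \<open>
  The components of \<open>quot_of_fract R\<close> are coprime, so a zero of the denominator is a genuine pole.
  The value at infinity is the limit there: the coefficient of the numerator
  vanishes if its degree is smaller than that of the denominator.
\<close>

fun rational_map :: "complex poly fract \<Rightarrow> riemann_sphere \<Rightarrow> riemann_sphere" where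
  "rational_map R (Fin z) =
     (let (P, Q) = quot_of_fract R
      in if poly Q z = 0 then Infty else Fin (poly P z / poly Q z))"
| "rational_map R Infty =
     (let (P, Q) = quot_of_fract R
      in if degree P > degree Q then Infty else Fin (coeff P (degree Q) / lead_coeff Q))"

definition chebyshev_L :: "complex poly \<Rightarrow> complex poly fract" where
  "chebyshev_L p = to_fract p * to_fract (pderiv (pderiv p)) / (to_fract (pderiv p))\<^sup>2"

definition chebyshev_fract :: "complex poly \<Rightarrow> complex poly fract" where
  "chebyshev_fract p =
     to_fract [:0, 1:] - (1 + 1 / 2 * chebyshev_L p) * (to_fract p / to_fract (pderiv p))"

definition chebyshev :: "complex poly \<Rightarrow> riemann_sphere \<Rightarrow> riemann_sphere" where
  "chebyshev p = rational_map (chebyshev_fract p)"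

text \<open>
  Normality in the sense of Montel. The limit \<open>g\<close> is unconstrained; in particular, constant limits
  and, for maps into the Riemann sphere, the limit \<open>Infty\<close> are allowed.
\<close>

definition normal_family_on ::
    "'a::topological_space set \<Rightarrow> ('a \<Rightarrow> 'b::metric_space) set \<Rightarrow> bool" where
  "normal_family_on U \<F> \<longleftrightarrow>
     (\<forall>f :: nat \<Rightarrow> 'a \<Rightarrow> 'b. range f \<subseteq> \<F> \<longrightarrow>
        (\<exists>r g. strict_mono (r :: nat \<Rightarrow> nat) \<and>
           (\<forall>K. compact K \<and> K \<subseteq> U \<longrightarrow> uniform_limit K (\<lambda>n. f (r n)) g sequentially)))"

definition fatou_set :: "('a::metric_space \<Rightarrow> 'a) \<Rightarrow> 'a set" where
  "fatou_set f = {x. \<exists>U. open U \<and> x \<in> U \<and> normal_family_on U {f ^^ n | n. n > 0}}"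

definition julia_set :: "('a::metric_space \<Rightarrow> 'a) \<Rightarrow> 'a set" where
  "julia_set f = - fatou_set f"

definition immediate_basin :: "('a::metric_space \<Rightarrow> 'a) \<Rightarrow> 'a \<Rightarrow> 'a set" where
  "immediate_basin f \<zeta> = connected_component_set (fatou_set f) \<zeta>"

definition poles :: "(riemann_sphere \<Rightarrow> riemann_sphere) \<Rightarrow> complex set" where
  "poles f = {z. f (Fin z) = Infty}"

text \<open>\<open>quartic b\<close> is $p_{-b}(z) = (z^2 - 1)(z^2 + b)$; note the sign of the parameter.\<close>

definition quartic :: "real \<Rightarrow> complex poly" where
  "quartic b = [:-1, 0, 1:] * [:of_real b, 0, 1:]"

end

theory Submission
  imports Defs
begin

text \<open>
  The real line with \<open>Infty\<close> is invariant, contains every pole, and misses the basins of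
  \<open>\<plusminus>\<i> * sqrt b\<close>. Suppose a compact connected set \<open>T\<close> in the Fatou set surrounds a Julia point.
  The iterates inside \<open>T\<close> cannot all omit the poles, by Montel's criterion, so by the open mapping
  theorem some image of \<open>T\<close> surrounds a pole. If \<open>T\<close> is a loop in one of the two basins, that image
  misses the real line, which joins the pole to infinity: hence the immediate basins are simply
  connected. If the Julia set is disconnected, such a \<open>T\<close> exists. Its image cannot surround \<open>0\<close>:
  it would meet the imaginary axis, on which the map expands by a factor of at least 4 outside the two
  basins, so it would lie in one of the basins and again miss the real line. Nor can it surround a
  nonzero pole when one of them lies on the boundary of an immediate basin: that pole (or, by
  symmetry, its negative) is joined to infinity by the unbounded basin, so the image would meet,
  hence lie in, a basin.
\<close>

text \<open>No classification of Fatou components and no count of critical points enters. The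
  dynamical input is that a basin is open and closed within the Fatou set, so that a connected
  subset of the Fatou set meeting the basin lies in it. The surrounding sets are arbitrary continua:
  an iterate of a loop need not be simple, and a disconnected Julia set at first yields only a
  component of a frontier. The notion \<open>inside\<close> makes sense for all of them. Since
  \<open>Infty\<close> is a Julia point, orbits of Fatou points stay finite, and the topology can be
  done in the plane.

  The factor 4 comes from L = p p'' / p'^2. The method leaves a point fixed where p = 0 or L = -2.
  At a nonzero point of the imaginary axis, L > -2 forces convergence to one of the two roots on the
  axis, while L \<le> -2 makes the derivative at least L^2 \<ge> 4. These two cases are
  complementary, so a segment of the axis cannot avoid for ever both the pole 0 and the two
  basins.\<close>

section \<open>The chordal metric\<close>

lemma dist_riemann_sphere_Fin:
  "dist (Fin z) (Fin w) = 2 * dist z w / sqrt ((1 + (cmod z)\<^sup>2) * (1 + (cmod w)\<^sup>2))"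
proof -
  define A B where "A = 1 + (cmod z)\<^sup>2" and "B = 1 + (cmod w)\<^sup>2"
  have pos: "A > 0" "B > 0"
    unfolding A_def B_def by (smt (verit) zero_le_power2)+
  have h: "((cmod z)\<^sup>2 - 1) / ((cmod z)\<^sup>2 + 1) = 1 - 2 / A"
    "((cmod w)\<^sup>2 - 1) / ((cmod w)\<^sup>2 + 1) = 1 - 2 / B"
    using pos by (simp_all add: A_def B_def field_simps)
  have A2: "A = 1 + (Re z)\<^sup>2 + (Im z)\<^sup>2" and B2: "B = 1 + (Re w)\<^sup>2 + (Im w)\<^sup>2"
    by (simp_all add: A_def B_def cmod_power2)
  have "(dist (Fin z) (Fin w))\<^sup>2 =
      (dist (2 * z / of_real A) (2 * w / of_real B))\<^sup>2 + (dist (1 - 2 / A) (1 - 2 / B))\<^sup>2"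
    using h by (simp add: dist_riemann_sphere_def dist_Pair_Pair A_def B_def)
  also have "\<dots> = (2 * Re z / A - 2 * Re w / B)\<^sup>2 + (2 * Im z / A - 2 * Im w / B)\<^sup>2
      + (2 / B - 2 / A)\<^sup>2"
    by (simp add: dist_norm cmod_power2)
  also have "\<dots> = 4 * ((Re z - Re w)\<^sup>2 + (Im z - Im w)\<^sup>2) / (A * B)"
  proof -
    have "A * B * ((2 * Re z / A - 2 * Re w / B)\<^sup>2 + (2 * Im z / A - 2 * Im w / B)\<^sup>2
      + (2 / B - 2 / A)\<^sup>2) * (A * B) = (4 * ((Re z - Re w)\<^sup>2 + (Im z - Im w)\<^sup>2)) * (A * B)"
      (is "?X = ?Y")
    proof -
      have "?X = 4 * ((B * Re z - A * Re w)\<^sup>2 + (B * Im z - A * Im w)\<^sup>2 + (A - B)\<^sup>2)"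
        using pos by (simp add: field_simps power2_eq_square)
      also have "\<dots> = ?Y"
        unfolding A2 B2 by algebra
      finally show ?thesis .
    qed
    then have "A * B * ((2 * Re z / A - 2 * Re w / B)\<^sup>2 + (2 * Im z / A - 2 * Im w / B)\<^sup>2
      + (2 / B - 2 / A)\<^sup>2) = 4 * ((Re z - Re w)\<^sup>2 + (Im z - Im w)\<^sup>2)"
      using pos by (metis mult_right_cancel mult_pos_pos less_irrefl)
    then show ?thesis
      using pos by (simp add: eq_divide_eq mult.commute)
  qed
  also have "\<dots> = (2 * dist z w / sqrt (A * B))\<^sup>2"
    using pos by (simp add: power_divide power_mult_distrib dist_norm cmod_power2)
  finally show ?thesis
    using pos unfolding A_def B_def by (smt (verit) power2_eq_iff_nonneg zero_le_dist
      divide_nonneg_nonneg real_sqrt_ge_zero mult_nonneg_nonneg)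
qed

lemma dist_Fin_le: "dist (Fin z) (Fin w) \<le> 2 * dist z w"
proof -
  have "1 * 1 \<le> (1 + (cmod z)\<^sup>2) * (1 + (cmod w)\<^sup>2)"
    by (intro mult_mono) auto
  then have "sqrt ((1 + (cmod z)\<^sup>2) * (1 + (cmod w)\<^sup>2)) \<ge> 1"
    by simp
  then have "2 * dist z w / sqrt ((1 + (cmod z)\<^sup>2) * (1 + (cmod w)\<^sup>2)) \<le> 2 * dist z w / 1"
    by (intro divide_left_mono) auto
  then show ?thesis
    by (simp add: dist_riemann_sphere_Fin)
qed

lemma continuous_on_Fin: "continuous_on S Fin"
proof (rule lipschitz_on_continuous_on)
  show "2-lipschitz_on S Fin"
    by (rule lipschitz_onI) (use dist_Fin_le in auto)
qed

lemma continuous_on_to_unit_sphere: "continuous_on S to_unit_sphere"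
  by (auto simp: continuous_on_iff dist_riemann_sphere_def)

text \<open>The value 0 at \<open>Infty\<close> is a mere default; the function serves as the
  coordinate of finite points.\<close>

primrec finite_part :: "riemann_sphere \<Rightarrow> complex" where
  "finite_part (Fin z) = z"
| "finite_part Infty = 0"

lemma Fin_finite_part [simp]: "x \<noteq> Infty \<Longrightarrow> Fin (finite_part x) = x"
  by (cases x) auto

text \<open>Away from \<open>Infty\<close> this is stereographic projection (u, s) \<mapsto> u / (1
  - s), and s \<noteq> 1 there.\<close>

lemma continuous_on_finite_part: "Infty \<notin> S \<Longrightarrow> continuous_on S finite_part"
proof -
  assume S: "Infty \<notin> S"
  have *: "finite_part x = fst (to_unit_sphere x) / of_real (1 - snd (to_unit_sphere x)) \<and>
      snd (to_unit_sphere x) \<noteq> 1" if "x \<in> S" for x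
  proof (cases x)
    case (Fin z)
    define A where "A = 1 + (cmod z)\<^sup>2"
    have "A > 0"
      unfolding A_def by (smt (verit) zero_le_power2)
    moreover have "((cmod z)\<^sup>2 - 1) / ((cmod z)\<^sup>2 + 1) = 1 - 2 / A"
      using \<open>A > 0\<close> by (simp add: A_def field_simps)
    moreover have "to_unit_sphere x = (2 * z / of_real A, ((cmod z)\<^sup>2 - 1) / ((cmod z)\<^sup>2 + 1))"
      by (simp add: Fin A_def)
    ultimately show ?thesis
      using Fin by (auto simp del: to_unit_sphere.simps)
  qed (use S that in auto)
  have "continuous_on S (\<lambda>x. fst (to_unit_sphere x) / of_real (1 - snd (to_unit_sphere x)))"
  proof (rule continuous_on_divide)
    show "continuous_on S (\<lambda>x. fst (to_unit_sphere x))"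
      by (intro continuous_on_fst continuous_on_to_unit_sphere)
    show "continuous_on S (\<lambda>x. complex_of_real (1 - snd (to_unit_sphere x)))"
      by (intro continuous_on_of_real continuous_on_diff continuous_on_const continuous_on_snd
          continuous_on_to_unit_sphere)
    show "\<forall>x\<in>S. complex_of_real (1 - snd (to_unit_sphere x)) \<noteq> 0"
      using * by auto
  qed
  then show ?thesis
    using * by (subst continuous_on_cong[OF refl]) auto
qed

lemma homeomorphism_Fin: "homeomorphism S (Fin ` S) Fin finite_part"
  by (rule homeomorphismI) (auto intro!: continuous_on_Fin continuous_on_finite_part)

lemma open_Fin_image:
  assumes "open U"
  shows "open (Fin ` U)"
proof -
  have "open (- {Infty} \<inter> finite_part -` U)"
    by (rule continuous_open_preimage) (auto intro: continuous_on_finite_part assms)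
  also have "- {Infty} \<inter> finite_part -` U = Fin ` U"
    by (auto simp: image_iff) (metis Fin_finite_part)
  finally show ?thesis .
qed

lemma tendsto_Fin_iff: "((\<lambda>n. Fin (f n)) \<longlongrightarrow> Fin z) F \<longleftrightarrow> (f \<longlongrightarrow> z) F"
proof
  assume L: "((\<lambda>n. Fin (f n)) \<longlongrightarrow> Fin z) F"
  have "continuous_on (- {Infty}) finite_part"
    by (rule continuous_on_finite_part) auto
  then have "isCont finite_part (Fin z)"
    by (metis ComplI closed_singleton continuous_on_eq_continuous_at open_Compl
        riemann_sphere.distinct(1) singletonD)
  from isCont_tendsto_compose[OF this L] show "(f \<longlongrightarrow> z) F"
    by simp
next
  assume "(f \<longlongrightarrow> z) F"
  moreover have "isCont Fin z"
    using continuous_on_Fin[of UNIV] by (simp add: continuous_on_eq_continuous_at)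
  ultimately show "((\<lambda>n. Fin (f n)) \<longlongrightarrow> Fin z) F"
    by (rule isCont_tendsto_compose[rotated])
qed

section \<open>Inversion as a second chart, and compactness of the sphere\<close>

fun sphere_inverse :: "riemann_sphere \<Rightarrow> riemann_sphere" where
  "sphere_inverse (Fin z) = (if z = 0 then Infty else Fin (inverse z))"
| "sphere_inverse Infty = Fin 0"

lemma sphere_inverse_involution [simp]: "sphere_inverse (sphere_inverse x) = x"
  by (cases x) auto

text \<open>On the unit sphere, z \<mapsto> 1/z is the half turn about the real axis. It is
  therefore an isometry exchanging 0 and \<open>Infty\<close>, which turns questions at
  \<open>Infty\<close> and at poles into questions at finite points.\<close>

lemma to_unit_sphere_inverse:
  "to_unit_sphere (sphere_inverse x) = (cnj (fst (to_unit_sphere x)), - snd (to_unit_sphere x))"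
proof (cases x)
  case (Fin z)
  show ?thesis
  proof (cases "z = 0")
    case False
    have m: "cmod z ^ 2 \<noteq> 0" "1 + cmod z ^ 2 \<noteq> 0"
      using False by (auto simp: add_nonneg_eq_0_iff)
    have r: "complex_of_real (cmod z ^ 2) = z * cnj z"
      by (rule complex_norm_square)
    have n: "1 + z * cnj z \<noteq> 0"
      using m(2) r by (metis of_real_1 of_real_add of_real_eq_0_iff)
    have "complex_of_real (1 + (cmod (inverse z))\<^sup>2) = 1 + inverse (z * cnj z)"
      by (simp add: norm_inverse power_inverse flip: r)
    also have "\<dots> = (1 + z * cnj z) / (z * cnj z)"
      using False by (simp add: field_simps)
    finally have "2 * inverse z / of_real (1 + (cmod (inverse z))\<^sup>2) = 2 * cnj z / (1 + z * cnj z)"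
      using False n by (simp only:) (simp add: field_simps)
    then have "2 * inverse z / of_real (1 + (cmod (inverse z))\<^sup>2) = 2 * cnj z / of_real (1 + (cmod z)\<^sup>2)"
      by (simp only: r of_real_add of_real_1)
    moreover have "((cmod (inverse z))\<^sup>2 - 1) / ((cmod (inverse z))\<^sup>2 + 1) =
        - (((cmod z)\<^sup>2 - 1) / ((cmod z)\<^sup>2 + 1))"
    proof -
      have "(inverse m - 1) / (inverse m + 1) = - ((m - 1) / (m + 1))" if "m > 0" for m :: real
        using that by (simp add: field_simps)
      then show ?thesis
        using False by (simp add: norm_inverse power_inverse)
    qed
    ultimately show ?thesis
      using Fin False by simp
  qed (use Fin in simp)
qed simp

lemma dist_sphere_inverse: "dist (sphere_inverse x) (sphere_inverse y) = dist x y"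
proof -
  have "dist (cnj u) (cnj v) = dist u v" for u v
    by (metis complex_cnj_diff complex_mod_cnj dist_norm)
  moreover have "dist (- a) (- b) = dist a b" for a b :: real
    by (simp add: dist_norm)
  ultimately show ?thesis
    by (simp add: dist_riemann_sphere_def to_unit_sphere_inverse dist_prod_def)
qed

lemma continuous_on_sphere_inverse: "continuous_on S sphere_inverse"
  by (auto simp: continuous_on_iff dist_sphere_inverse)

lemma open_sphere_inverse_image: "open U \<Longrightarrow> open (sphere_inverse ` U)"
proof -
  assume "open U"
  then have "open (sphere_inverse -` U)"
    by (intro open_vimage continuous_on_sphere_inverse)
  also have "sphere_inverse -` U = sphere_inverse ` U"
    by (force simp: image_iff)
  finally show ?thesis .
qed

text \<open>The closed unit disc and its image under inversion cover the sphere.\<close>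

lemma compact_riemann_sphere: "compact (UNIV :: riemann_sphere set)"
proof -
  have "compact (Fin ` cball 0 1 \<union> sphere_inverse ` Fin ` cball 0 1)"
    by (intro compact_Un compact_continuous_image continuous_on_Fin continuous_on_sphere_inverse
        compact_cball)
  also have "Fin ` cball 0 1 \<union> sphere_inverse ` Fin ` cball 0 1 = UNIV"
  proof -
    have "x \<in> Fin ` cball 0 1 \<union> sphere_inverse ` Fin ` cball 0 1" for x
    proof (cases x)
      case (Fin z)
      show ?thesis
      proof (cases "cmod z \<le> 1")
        case False
        then have "z \<noteq> 0"
          by auto
        with False have "x = sphere_inverse (Fin (inverse z))" "cmod (inverse z) \<le> 1"
          using Fin by (auto simp: norm_inverse inverse_le_1_iff)
        then show ?thesis
          by (metis UnI2 image_eqI mem_cball_0)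
      qed (use Fin in auto)
    next
      case Infty
      then have "x = sphere_inverse (Fin 0)"
        by simp
      then show ?thesis
        by (metis UnI2 centre_in_cball image_eqI zero_le_one)
    qed
    then show ?thesis
      by blast
  qed
  finally show ?thesis .
qed

section \<open>Fatou sets and basins\<close>

lemma open_fatou_set: "open (fatou_set f)"
  unfolding open_subopen[of "fatou_set f"] by (auto simp: fatou_set_def)

text \<open>Since the space is compact, a closed ball inside the neighbourhood is compact, and
  uniform convergence can be used on it directly. The exponents \<open>k i\<close> are arbitrary
  positive numbers, not increasing ones, because a sequence of iterates may repeat.\<close>

lemma fatou_setE:
  assumes "x \<in> fatou_set f" and "compact (UNIV :: 'a::metric_space set)"
  obtains e :: real where "e > 0" "compact (cball (x :: 'a) e)"
    "\<And>k :: nat \<Rightarrow> nat. (\<And>i. k i > 0) \<Longrightarrow>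
       \<exists>r g. strict_mono (r :: nat \<Rightarrow> nat) \<and>
         uniform_limit (cball x e) (\<lambda>n. f ^^ k (r n)) g sequentially"
proof -
  obtain U where U: "open U" "x \<in> U" "normal_family_on U {f ^^ n | n. n > 0}"
    using assms(1) by (auto simp: fatou_set_def)
  obtain e where e: "e > 0" "cball x e \<subseteq> U"
    using U open_contains_cball by blast
  have K: "compact (cball x e)"
    using compact_Int_closed[OF assms(2) closed_cball] by simp
  show thesis
  proof
    fix k :: "nat \<Rightarrow> nat" assume "\<And>i. k i > 0"
    then have "range (\<lambda>i. f ^^ k i) \<subseteq> {f ^^ n | n. n > 0}"
      by auto
    then obtain r g where rg: "strict_mono (r :: nat \<Rightarrow> nat)"
      "\<forall>K. compact K \<and> K \<subseteq> U \<longrightarrow> uniform_limit K (\<lambda>n. f ^^ k (r n)) g sequentially"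
      using U(3)[unfolded normal_family_on_def, rule_format, of "\<lambda>i. f ^^ k i"] by blast
    then show "\<exists>r g. strict_mono (r :: nat \<Rightarrow> nat) \<and>
         uniform_limit (cball x e) (\<lambda>n. f ^^ k (r n)) g sequentially"
      using K e(2) by blast
  qed (use e K in auto)
qed

lemma continuous_on_funpow:
  fixes f :: "'a::topological_space \<Rightarrow> 'a"
  shows "continuous_on UNIV f \<Longrightarrow> continuous_on UNIV (f ^^ n)"
proof (induction n)
  case (Suc n)
  then have "continuous_on UNIV (f \<circ> f ^^ n)"
    by (intro continuous_on_compose) (auto intro: continuous_on_subset)
  then show ?case
    by simp
qed (simp add: id_def)

text \<open>Iterates near \<open>f x\<close> are pulled back to \<open>x\<close> by f^k \<circ> f =
  f^(k+1). On a neighbourhood of \<open>f x\<close> covered by the image of a ball around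
  \<open>x\<close>, any right inverse \<open>s\<close> of \<open>f\<close> carries the uniform
  convergence over. It may be discontinuous, since normality does not ask the limit
  \<open>g \<circ> s\<close> to be continuous.\<close>

lemma fatou_set_forward:
  assumes comp: "compact (UNIV :: 'a::metric_space set)" and x: "(x :: 'a) \<in> fatou_set f"
    and op: "\<And>U. open U \<Longrightarrow> x \<in> U \<Longrightarrow> \<exists>V. open V \<and> f x \<in> V \<and> V \<subseteq> f ` U"
  shows "f x \<in> fatou_set f"
proof -
  obtain e where e: "e > 0"
    and lim: "\<And>k :: nat \<Rightarrow> nat. (\<And>i. k i > 0) \<Longrightarrow>
       \<exists>r g. strict_mono (r :: nat \<Rightarrow> nat) \<and>
         uniform_limit (cball x e) (\<lambda>n. f ^^ k (r n)) g sequentially"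
    using fatou_setE[OF x comp] by metis
  obtain V where V: "open V" "f x \<in> V" "V \<subseteq> f ` ball x e"
    using op[of "ball x e"] e by auto
  have "normal_family_on V {f ^^ n | n. n > 0}"
    unfolding normal_family_on_def
  proof (intro allI impI)
    fix F :: "nat \<Rightarrow> 'a \<Rightarrow> 'a" assume "range F \<subseteq> {f ^^ n | n. n > 0}"
    then have "\<forall>i. \<exists>n>0. F i = f ^^ n"
      by auto
    then obtain k where k: "\<And>i. k i > 0" "\<And>i. F i = f ^^ k i"
      by metis
    obtain r g where r: "strict_mono (r :: nat \<Rightarrow> nat)"
      and u: "uniform_limit (cball x e) (\<lambda>n. f ^^ (Suc (k (r n)))) g sequentially"
      using lim[of "\<lambda>i. Suc (k i)"] by auto
    define s where "s = inv_into (cball x e) f"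
    have s: "s y \<in> cball x e \<and> f (s y) = y" if "y \<in> V" for y
      using V(3) that unfolding s_def
      by (metis ball_subset_cball f_inv_into_f image_mono inv_into_into subsetD)
    have "uniform_limit V (\<lambda>n. F (r n)) (g \<circ> s) sequentially"
      unfolding uniform_limit_iff
    proof (intro allI impI)
      fix d :: real assume "d > 0"
      with u have "\<forall>\<^sub>F n in sequentially. \<forall>w\<in>cball x e. dist ((f ^^ Suc (k (r n))) w) (g w) < d"
        by (simp add: uniform_limit_iff)
      then show "\<forall>\<^sub>F n in sequentially. \<forall>y\<in>V. dist (F (r n) y) ((g \<circ> s) y) < d"
        by eventually_elim (metis comp_apply funpow_Suc_right k(2) s)
    qed
    then show "\<exists>r g. strict_mono r \<and>
        (\<forall>K. compact K \<and> K \<subseteq> V \<longrightarrow> uniform_limit K (\<lambda>n. F (r n)) g sequentially)"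
      using r uniform_limit_on_subset by blast
  qed
  then show ?thesis
    using V by (auto simp: fatou_set_def)
qed

section \<open>Full basins of attraction, relatively clopen in the Fatou set\<close>

definition basin :: "('a::topological_space \<Rightarrow> 'a) \<Rightarrow> 'a \<Rightarrow> 'a set" where
  "basin f \<zeta> = {x. (\<lambda>n. (f ^^ n) x) \<longlonglongrightarrow> \<zeta>}"

lemma funpow_in_basin_iff: "(f ^^ k) x \<in> basin f \<zeta> \<longleftrightarrow> x \<in> basin f \<zeta>"
proof -
  have *: "(\<lambda>n. (f ^^ n) ((f ^^ k) x)) = (\<lambda>n. (f ^^ (n + k)) x)"
    by (simp add: funpow_add)
  show ?thesis
    unfolding basin_def mem_Collect_eq *
    using LIMSEQ_ignore_initial_segment[of "\<lambda>n. (f ^^ n) x" \<zeta> k]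
      LIMSEQ_offset[of "\<lambda>n. (f ^^ n) x" k \<zeta>] by blast
qed

text \<open>Attraction is encoded by a neighbourhood \<open>B\<close> on which the iterates converge
  uniformly. This makes sense in any metric space and leaves derivatives to the place where a
  concrete \<open>B\<close> is produced.\<close>

locale attracting_point =
  fixes f :: "'a::metric_space \<Rightarrow> 'a" and \<zeta> :: 'a and B :: "'a set"
  assumes cont: "continuous_on UNIV f"
    and open_B: "open B" and \<zeta>_in_B: "\<zeta> \<in> B"
    and uniform_B: "uniform_limit B (\<lambda>n. f ^^ n) (\<lambda>_. \<zeta>) sequentially"
begin

lemma B_subset_basin: "B \<subseteq> basin f \<zeta>"
  unfolding basin_def using tendsto_uniform_limitI[OF uniform_B] by blast

lemma basin_enters_B: "x \<in> basin f \<zeta> \<Longrightarrow> \<exists>n. (f ^^ n) x \<in> B"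
proof -
  assume "x \<in> basin f \<zeta>"
  then have "\<forall>\<^sub>F n in sequentially. (f ^^ n) x \<in> B"
    using open_B \<zeta>_in_B by (simp add: basin_def topological_tendstoD)
  then show ?thesis
    using eventually_happens' sequentially_bot by blast
qed

lemma basin_eq: "basin f \<zeta> = (\<Union>n. (f ^^ n) -` B)"
  using basin_enters_B B_subset_basin funpow_in_basin_iff by fastforce

lemma open_basin: "open (basin f \<zeta>)"
  unfolding basin_eq by (intro open_UN ballI open_vimage open_B continuous_on_funpow cont)

text \<open>A sequence of exponents either takes one value infinitely often, giving a constant
  subsequence of maps, or tends to infinity, and then the whole sequence of iterates converges
  uniformly to \<open>\<zeta>\<close>.\<close>

lemma basin_subset_fatou_set: "basin f \<zeta> \<subseteq> fatou_set f"
proof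
  fix x assume "x \<in> basin f \<zeta>"
  then obtain N where N: "(f ^^ N) x \<in> B"
    using basin_enters_B by blast
  define U where "U = (f ^^ N) -` B"
  have "open U"
    unfolding U_def by (intro open_vimage open_B continuous_on_funpow cont)
  have unif: "uniform_limit U (\<lambda>n. f ^^ n) (\<lambda>_. \<zeta>) sequentially"
    unfolding uniform_limit_sequentially_iff
  proof (intro allI impI)
    fix e :: real assume "e > 0"
    then obtain M where M: "\<And>n y. n \<ge> M \<Longrightarrow> y \<in> B \<Longrightarrow> dist ((f ^^ n) y) \<zeta> < e"
      using uniform_B unfolding uniform_limit_sequentially_iff by blast
    have "dist ((f ^^ n) y) \<zeta> < e" if "n \<ge> M + N" "y \<in> U" for n y
    proof -
      have "(f ^^ n) y = (f ^^ (n - N)) ((f ^^ N) y)"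
        using that by (metis add_leE comp_apply funpow_add le_add_diff_inverse2)
      then show ?thesis
        using M[of "n - N" "(f ^^ N) y"] that by (simp add: U_def)
    qed
    then show "\<exists>M. \<forall>n\<ge>M. \<forall>x\<in>U. dist ((f ^^ n) x) \<zeta> < e"
      by blast
  qed
  have "normal_family_on U {f ^^ n | n. n > 0}"
    unfolding normal_family_on_def
  proof (intro allI impI)
    fix F :: "nat \<Rightarrow> 'a \<Rightarrow> 'a" assume "range F \<subseteq> {f ^^ n | n. n > 0}"
    then have "\<forall>i. \<exists>n. F i = f ^^ n"
      by auto
    then obtain k where k: "\<And>i. F i = f ^^ k i"
      by metis
    show "\<exists>r g. strict_mono r \<and>
        (\<forall>K. compact K \<and> K \<subseteq> U \<longrightarrow> uniform_limit K (\<lambda>n. F (r n)) g sequentially)"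
    proof (cases "\<exists>m. infinite {i. k i = m}")
      case True
      then obtain m where m: "infinite {i. k i = m}" ..
      then obtain r :: "nat \<Rightarrow> nat" where r: "strict_mono r" "\<And>n. r n \<in> {i. k i = m}"
        using infinite_enumerate by blast
      then have "(\<lambda>n. F (r n)) = (\<lambda>n. f ^^ m)"
        using k by auto
      then show ?thesis
        using r(1) uniform_limit_const by metis
    next
      case False
      have "filterlim k at_top sequentially"
        unfolding filterlim_at_top
      proof
        fix M
        have "finite (\<Union>m<M. {i. k i = m})"
          using False by blast
        moreover have "{i. \<not> M \<le> k i} \<subseteq> (\<Union>m<M. {i. k i = m})"
          by auto
        ultimately have "finite {i. \<not> M \<le> k i}"
          by (rule finite_subset[rotated])
        then show "\<forall>\<^sub>F i in sequentially. M \<le> k i"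
          by (simp only: eventually_cofinite flip: cofinite_eq_sequentially)
      qed
      then have "uniform_limit U (\<lambda>i. f ^^ k i) (\<lambda>_. \<zeta>) sequentially"
        by (rule filterlim_compose[OF unif])
      moreover have "F = (\<lambda>i. f ^^ k i)"
        using k by auto
      ultimately have "\<forall>K. compact K \<and> K \<subseteq> U \<longrightarrow>
          uniform_limit K (\<lambda>n. F (id n)) (\<lambda>_. \<zeta>) sequentially"
        using uniform_limit_on_subset by auto
      then show ?thesis
        using strict_mono_id by blast
    qed
  qed
  then show "x \<in> fatou_set f"
    using \<open>open U\<close> N by (auto simp: fatou_set_def U_def)
qed

text \<open>Near a Fatou point some subsequence of iterates has a continuous limit. It equals
  \<open>\<zeta>\<close> at nearby points of the basin, hence also at \<open>x\<close> by
  continuity, and so the orbit of \<open>x\<close> enters \<open>B\<close>.\<close>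

lemma fatou_closure_basin:
  assumes comp: "compact (UNIV :: 'a set)" and x: "x \<in> fatou_set f" "x \<in> closure (basin f \<zeta>)"
  shows "x \<in> basin f \<zeta>"
proof -
  obtain e where e: "e > 0"
    and lim: "\<And>k :: nat \<Rightarrow> nat. (\<And>i. k i > 0) \<Longrightarrow>
       \<exists>r g. strict_mono (r :: nat \<Rightarrow> nat) \<and>
         uniform_limit (cball x e) (\<lambda>n. f ^^ k (r n)) g sequentially"
    using fatou_setE[OF x(1) comp] by metis
  obtain r g where r: "strict_mono (r :: nat \<Rightarrow> nat)"
    and u: "uniform_limit (cball x e) (\<lambda>n. f ^^ Suc (r n)) g sequentially"
    using lim[of Suc] by auto
  have contg: "continuous_on (cball x e) g"
    by (rule uniform_limit_theorem[OF _ u])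
      (auto intro!: always_eventually continuous_on_subset[OF continuous_on_funpow[OF cont]]
        simp del: funpow.simps)
  have sub: "strict_mono (\<lambda>n. Suc (r n))"
    using r by (simp add: strict_mono_def)
  have g: "g y = \<zeta>" if "y \<in> basin f \<zeta>" "y \<in> cball x e" for y
  proof -
    have "(\<lambda>n. (f ^^ Suc (r n)) y) \<longlonglongrightarrow> g y"
      by (rule tendsto_uniform_limitI[OF u that(2)])
    moreover have "(\<lambda>n. (f ^^ Suc (r n)) y) \<longlonglongrightarrow> \<zeta>"
      using LIMSEQ_subseq_LIMSEQ[of "\<lambda>n. (f ^^ n) y" \<zeta>, OF _ sub] that(1)
      by (simp add: basin_def o_def)
    ultimately show ?thesis
      by (rule LIMSEQ_unique)
  qed
  obtain s where s: "\<And>n. s n \<in> basin f \<zeta>" "s \<longlonglongrightarrow> x"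
    using x(2) by (auto simp: closure_sequential)
  have ev: "\<forall>\<^sub>F n in sequentially. s n \<in> cball x e"
    using topological_tendstoD[OF s(2) open_ball[of x e]] e
    by (auto elim!: eventually_mono)
  have "(\<lambda>n. g (s n)) \<longlonglongrightarrow> g x"
    by (rule continuous_on_tendsto_compose[OF contg s(2) _ ev]) (use e in auto)
  moreover have "(\<lambda>n. g (s n)) \<longlonglongrightarrow> \<zeta>"
    by (rule tendsto_eventually) (use ev in eventually_elim, use g s in auto)
  ultimately have "g x = \<zeta>"
    by (rule LIMSEQ_unique)
  then have "(\<lambda>n. (f ^^ Suc (r n)) x) \<longlonglongrightarrow> \<zeta>"
    using tendsto_uniform_limitI[OF u, of x] e by simp
  then have "\<forall>\<^sub>F n in sequentially. (f ^^ Suc (r n)) x \<in> B"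
    using open_B \<zeta>_in_B topological_tendstoD by blast
  then obtain n where "(f ^^ Suc (r n)) x \<in> B"
    using eventually_happens' sequentially_bot by blast
  then show ?thesis
    using B_subset_basin funpow_in_basin_iff by blast
qed

text \<open>Within the Fatou set the basin is open, and by \<open>fatou_closure_basin\<close> so is
  its complement.\<close>

lemma connected_fatou_subset_basin:
  assumes comp: "compact (UNIV :: 'a set)"
    and S: "connected S" "S \<subseteq> fatou_set f" "S \<inter> basin f \<zeta> \<noteq> {}"
  shows "S \<subseteq> basin f \<zeta>"
proof -
  have "S \<subseteq> basin f \<zeta> \<union> - closure (basin f \<zeta>)"
    using fatou_closure_basin[OF comp] S(2) by blast
  moreover have "basin f \<zeta> \<inter> - closure (basin f \<zeta>) \<inter> S = {}"
    using closure_subset by blast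
  ultimately have "- closure (basin f \<zeta>) \<inter> S = {}"
    using connectedD[OF S(1) open_basin, of "- closure (basin f \<zeta>)"] S(3) by blast
  then show ?thesis
    using fatou_closure_basin[OF comp] S(2) by blast
qed

end

section \<open>Rational maps of the sphere\<close>

text \<open>Unequal degrees exclude P = k Q, so the quotient is nonconstant on every disc and the
  open mapping theorem applies.\<close>

lemma open_poly_quotient_image:
  fixes P Q :: "complex poly"
  assumes "open W" "\<And>z. z \<in> W \<Longrightarrow> poly Q z \<noteq> 0" "degree P \<noteq> degree Q" "P \<noteq> 0"
  shows "open ((\<lambda>z. poly P z / poly Q z) ` W)"
proof (subst open_subopen, safe)
  fix z assume "z \<in> W"
  then obtain r where r: "r > 0" "ball z r \<subseteq> W"
    using \<open>open W\<close> open_contains_ball by blast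
  let ?f = "\<lambda>z. poly P z / poly Q z"
  have "open (?f ` ball z r)"
  proof (rule open_mapping_thm[of _ "ball z r"])
    show "?f holomorphic_on ball z r"
      by (intro holomorphic_intros) (use assms(2) r in auto)
    show "\<not> ?f constant_on ball z r"
    proof
      assume "?f constant_on ball z r"
      then obtain k where k: "\<And>x. x \<in> ball z r \<Longrightarrow> ?f x = k"
        by (auto simp: constant_on_def)
      have "poly (P - smult k Q) x = 0" if "x \<in> ball z r" for x
        using k[OF that] assms(2)[of x] r that by (auto simp: field_simps)
      then have "ball z r \<subseteq> {x. poly (P - smult k Q) x = 0}"
        by blast
      moreover have "infinite (ball z r)"
        using r(1) by (intro uncountable_infinite uncountable_ball)
      ultimately have "P = smult k Q"
        using poly_roots_finite[of "P - smult k Q"] finite_subset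
          eq_iff_diff_eq_0[of P "smult k Q"] by blast
      then show False
        using assms(3,4) by (metis degree_smult_eq smult_0_left)
    qed
  qed auto
  then show "\<exists>T. open T \<and> ?f z \<in> T \<and> T \<subseteq> ?f ` W"
    using r by (intro exI[of _ "?f ` ball z r"]) auto
qed

text \<open>The degree condition is what makes \<open>Infty\<close> a fixed point. Besides
  Chebyshev's method, the affine maps that normalise omitted values and the symmetry z \<mapsto> -z
  are instances, which yields their continuity on the sphere.\<close>

locale rational_sphere_map =
  fixes P Q :: "complex poly" and C :: "riemann_sphere \<Rightarrow> riemann_sphere"
  assumes no_common_zero: "poly Q z = 0 \<Longrightarrow> poly P z \<noteq> 0"
    and Q_nonzero: "Q \<noteq> 0" and degree_less: "degree Q < degree P"
    and C_Fin: "C (Fin z) = (if poly Q z = 0 then Infty else Fin (poly P z / poly Q z))"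
    and C_Infty: "C Infty = Infty"
begin

lemma P_nonzero: "P \<noteq> 0"
  using degree_less by auto

lemma C_near_pole:
  "poly P z \<noteq> 0 \<Longrightarrow> C (Fin z) = sphere_inverse (Fin (poly Q z / poly P z))"
  by (simp add: C_Fin)

text \<open>In the coordinate w = 1/z a polynomial of degree n becomes w^(-n) times its reflected
  polynomial. The remaining power of w is positive, so the map in this chart fixes w = 0.\<close>

lemma C_near_Infty:
  assumes "poly (reflect_poly P) w \<noteq> 0"
  shows "C (sphere_inverse (Fin w)) = sphere_inverse (Fin
    (w ^ (degree P - degree Q) * poly (reflect_poly Q) w / poly (reflect_poly P) w))"
proof (cases "w = 0")
  case False
  then have P: "poly (reflect_poly P) w = w ^ degree P * poly P (inverse w)"
    and Q: "poly (reflect_poly Q) w = w ^ degree Q * poly Q (inverse w)"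
    by (simp_all add: poly_reflect_poly_nz)
  have "w ^ (degree P - degree Q) * (w ^ degree Q * poly Q (inverse w)) =
      w ^ degree P * poly Q (inverse w)"
    using degree_less by (simp flip: mult.assoc power_add)
  then have "w ^ (degree P - degree Q) * poly (reflect_poly Q) w / poly (reflect_poly P) w =
      poly Q (inverse w) / poly P (inverse w)"
    using False unfolding P Q by (simp only: mult_divide_mult_cancel_left power_not_zero not_False_eq_True)
  then show ?thesis
    using False assms C_near_pole[of "inverse w"] by (simp add: P)
qed (use degree_less in \<open>simp add: C_Infty\<close>)

text \<open>Three open charts cover the sphere: the complement of the poles, the complement of the
  zeros of \<open>P\<close>, and a neighbourhood of \<open>Infty\<close>. The first two cover all
  finite points because \<open>P\<close> and \<open>Q\<close> have no common zero.\<close>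

lemma continuous_C: "continuous_on UNIV C"
proof -
  define S1 S2 S3 where "S1 = Fin ` {z. poly Q z \<noteq> 0}" and "S2 = Fin ` {z. poly P z \<noteq> 0}"
    and "S3 = sphere_inverse ` Fin ` {w. poly (reflect_poly P) w \<noteq> 0}"
  have open_nz: "open {z. poly R z \<noteq> 0}" for R :: "complex poly"
    by (intro open_Collect_neq continuous_intros)
  have op: "open S1" "open S2" "open S3"
    unfolding S1_def S2_def S3_def
    by (intro open_Fin_image open_sphere_inverse_image open_nz)+
  have 1: "continuous_on S1 C"
  proof (rule continuous_on_eq)
    show "continuous_on S1 (Fin \<circ> (\<lambda>z. poly P z / poly Q z) \<circ> finite_part)"
      by (intro continuous_on_compose continuous_on_finite_part continuous_on_Fin)
        (auto simp: S1_def intro!: continuous_intros)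
  qed (auto simp: S1_def C_Fin)
  have 2: "continuous_on S2 C"
  proof (rule continuous_on_eq)
    show "continuous_on S2 (sphere_inverse \<circ> Fin \<circ> (\<lambda>z. poly Q z / poly P z) \<circ> finite_part)"
      by (intro continuous_on_compose continuous_on_finite_part continuous_on_Fin
          continuous_on_sphere_inverse) (auto simp: S2_def intro!: continuous_intros)
  qed (auto simp: S2_def C_near_pole)
  have 3: "continuous_on S3 C"
  proof (rule continuous_on_eq)
    show "continuous_on S3 (sphere_inverse \<circ> Fin \<circ> (\<lambda>w. w ^ (degree P - degree Q) *
        poly (reflect_poly Q) w / poly (reflect_poly P) w) \<circ> finite_part \<circ> sphere_inverse)"
      by (intro continuous_on_compose continuous_on_finite_part continuous_on_Fin
          continuous_on_sphere_inverse)
        (auto simp: S3_def image_iff simp del: sphere_inverse.simps intro!: continuous_intros)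
  qed (auto simp: S3_def C_near_Infty simp del: sphere_inverse.simps)
  have "x \<in> S1 \<union> S2 \<union> S3" for x
  proof (cases x)
    case (Fin z)
    then show ?thesis
      using no_common_zero[of z] by (auto simp: S1_def S2_def)
  next
    case Infty
    then have "x = sphere_inverse (Fin 0)"
      by simp
    moreover have "poly (reflect_poly P) 0 \<noteq> 0"
      using P_nonzero by simp
    ultimately show ?thesis
      unfolding S3_def by blast
  qed
  then have "S1 \<union> S2 \<union> S3 = UNIV"
    by blast
  then show ?thesis
    using continuous_on_open_Un[OF _ op(3) continuous_on_open_Un[OF op(1,2) 1 2] 3] op by auto
qed

text \<open>Openness at finite points gives forward invariance of the Fatou set once
  \<open>Infty\<close> is known to be a Julia point.\<close>

lemma C_open_at_Fin:
  assumes "open U" "Fin z \<in> U"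
  shows "\<exists>V. open V \<and> C (Fin z) \<in> V \<and> V \<subseteq> C ` U"
proof -
  have oU: "open (Fin -` U)"
    by (intro open_vimage assms continuous_on_Fin)
  have open_nz: "open {z. poly R z \<noteq> 0}" for R :: "complex poly"
    by (intro open_Collect_neq continuous_intros)
  show ?thesis
  proof (cases "poly Q z = 0")
    case False
    let ?W = "Fin -` U \<inter> {z. poly Q z \<noteq> 0}" and ?f = "\<lambda>z. poly P z / poly Q z"
    have "open (Fin ` ?f ` ?W)"
      using oU open_nz degree_less P_nonzero
      by (intro open_Fin_image open_poly_quotient_image open_Int) auto
    moreover have "C (Fin z) \<in> Fin ` ?f ` ?W"
      using False assms(2) by (auto simp: C_Fin)
    moreover have "Fin ` ?f ` ?W \<subseteq> C ` U"
      by (auto simp: C_Fin image_iff intro!: bexI[of _ "Fin _"])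
    ultimately show ?thesis
      by blast
  next
    case True
    let ?W = "Fin -` U \<inter> {z. poly P z \<noteq> 0}" and ?f = "\<lambda>z. poly Q z / poly P z"
    have "open (sphere_inverse ` Fin ` ?f ` ?W)"
      using oU open_nz degree_less Q_nonzero
      by (intro open_Fin_image open_sphere_inverse_image open_poly_quotient_image open_Int) auto
    moreover have "C (Fin z) \<in> sphere_inverse ` Fin ` ?f ` ?W"
      using no_common_zero[OF True] assms(2) C_near_pole[of z] by blast
    moreover have "sphere_inverse ` Fin ` ?f ` ?W \<subseteq> C ` U"
      using C_near_pole by (auto simp: image_iff simp del: sphere_inverse.simps) metis
    ultimately show ?thesis
      by blast
  qed
qed

lemma fatou_forward:
  assumes "Infty \<notin> fatou_set C" "x \<in> fatou_set C"
  shows "(C ^^ n) x \<in> fatou_set C"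
proof (induction n)
  case (Suc n)
  then obtain z where z: "(C ^^ n) x = Fin z"
    using assms(1) by (metis riemann_sphere.exhaust)
  have "C (Fin z) \<in> fatou_set C"
    by (rule fatou_set_forward[OF compact_riemann_sphere _ C_open_at_Fin]) (use Suc z in auto)
  then show ?case
    by (simp add: z)
qed (use assms in simp)

text \<open>As \<open>Infty\<close> is fixed, avoiding it at time n means avoiding it at all earlier
  times, so no pole is met in the induction.\<close>

lemma holomorphic_iterate:
  assumes "\<And>z. z \<in> S \<Longrightarrow> (C ^^ n) (Fin z) \<noteq> Infty"
  shows "(\<lambda>z. finite_part ((C ^^ n) (Fin z))) holomorphic_on S"
  using assms
proof (induction n)
  case (Suc n)
  have fin: "(C ^^ n) (Fin z) \<noteq> Infty" if "z \<in> S" for z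
    using Suc.prems[OF that] C_Infty by auto
  let ?h = "\<lambda>z. finite_part ((C ^^ n) (Fin z))"
  have step: "(C ^^ Suc n) (Fin z) = C (Fin (?h z))" if "z \<in> S" for z
    using fin[OF that] by simp
  have nz: "poly Q (?h z) \<noteq> 0" if "z \<in> S" for z
    using Suc.prems[OF that] step[OF that] by (auto simp: C_Fin split: if_splits)
  have "(\<lambda>z. poly P (?h z) / poly Q (?h z)) holomorphic_on S"
    by (intro holomorphic_intros Suc.IH fin) (use nz in auto)
  then show ?case
    by (rule holomorphic_transform) (simp only: step C_Fin nz if_False finite_part.simps)
qed (simp add: id_def)

end

section \<open>Montel's criterion\<close>

lemma uniform_limit_sphere_compose:
  fixes T :: "riemann_sphere \<Rightarrow> riemann_sphere"
  assumes "continuous_on UNIV T" "uniform_limit K f g F"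
  shows "uniform_limit K (\<lambda>n x. T (f n x)) (\<lambda>x. T (g x)) F"
proof (rule uniform_limitI)
  fix e :: real assume "e > 0"
  have "uniformly_continuous_on UNIV T"
    using assms(1) compact_riemann_sphere by (rule compact_uniformly_continuous)
  then obtain d where d: "d > 0" "\<And>x y. dist x y < d \<Longrightarrow> dist (T x) (T y) < e"
    using \<open>e > 0\<close> unfolding uniformly_continuous_on_def by (metis UNIV_I dist_commute)
  show "\<forall>\<^sub>F n in F. \<forall>x\<in>K. dist (T (f n x)) (T (g x)) < e"
    using uniform_limitD[OF assms(2) d(1)] by eventually_elim (use d in auto)
qed

lemma uniform_limit_Fin:
  assumes "uniform_limit K f g F"
  shows "uniform_limit K (\<lambda>n x. Fin (f n x)) (\<lambda>x. Fin (g x)) F"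
proof (rule uniform_limitI)
  fix e :: real assume "e > 0"
  then have "\<forall>\<^sub>F n in F. \<forall>x\<in>K. dist (f n x) (g x) < e / 2"
    using uniform_limitD[OF assms, of "e / 2"] by simp
  then show "\<forall>\<^sub>F n in F. \<forall>x\<in>K. dist (Fin (f n x)) (Fin (g x)) < e"
    by eventually_elim (smt (verit) dist_Fin_le field_sum_of_halves)
qed

text \<open>By the Schottky-type bound \<open>GPicard3\<close>, functions omitting 0 and 1 that are
  bounded at one point are bounded on compact sets. It applies to the subsequence with values of
  modulus at most 1 at \<open>w\<close>; Montel's theorem for bounded families does the
  rest.\<close>

lemma Montel_bounded_at_point:
  assumes S: "open S" "connected S" "w \<in> S"
    and hol: "\<And>n. h n holomorphic_on S"
    and omit: "\<And>n z. z \<in> S \<Longrightarrow> h n z \<noteq> 0 \<and> h n z \<noteq> 1"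
    and inf: "infinite {n :: nat. cmod (h n w) \<le> 1}"
  obtains r g where "strict_mono (r :: nat \<Rightarrow> nat)"
    "\<And>K. compact K \<Longrightarrow> K \<subseteq> S \<Longrightarrow> uniform_limit K (\<lambda>n. h (r n)) g sequentially"
proof -
  obtain r1 :: "nat \<Rightarrow> nat" where r1: "strict_mono r1" "\<And>n. cmod (h (r1 n) w) \<le> 1"
    using infinite_enumerate[OF inf] by blast
  have bd: "\<exists>B. \<forall>f\<in>range (h \<circ> r1). \<forall>z\<in>K. cmod (f z) \<le> B" if K: "compact K" "K \<subseteq> S" for K
  proof -
    obtain B where "\<And>f z. f \<in> range (h \<circ> r1) \<Longrightarrow> z \<in> K \<Longrightarrow> cmod (f z) \<le> B"
      by (rule GPicard3[OF S, of "range (h \<circ> r1)" "range h" K]) (use K hol omit r1 in auto)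
    then show ?thesis
      by blast
  qed
  obtain g r2 where r2: "strict_mono (r2 :: nat \<Rightarrow> nat)"
    and lim: "\<And>K. compact K \<Longrightarrow> K \<subseteq> S \<Longrightarrow> uniform_limit K ((h \<circ> r1) \<circ> r2) g sequentially"
    by (rule Montel[OF S(1), of "range (h \<circ> r1)" "h \<circ> r1"]) (use hol bd in auto)
  show thesis
  proof (rule that)
    show "strict_mono (r1 \<circ> r2)"
      by (rule strict_mono_o[OF r1(1) r2])
    show "uniform_limit K (\<lambda>n. h ((r1 \<circ> r2) n)) g sequentially" if "compact K" "K \<subseteq> S" for K
      using lim[OF that] by (simp add: o_def)
  qed
qed

text \<open>After normalising the omitted values to 0 and 1, infinitely many of the functions or
  infinitely many of their reciprocals have modulus at most 1 at \<open>w\<close>. The reciprocals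
  also omit 0 and 1, and inversion of the sphere takes their limit back; this is why the limit must
  be allowed to be \<open>Infty\<close>.\<close>

lemma Montel_omitted_values:
  assumes S: "open S" "connected S" and "\<alpha> \<noteq> \<beta>"
    and hol: "\<And>n. f n holomorphic_on S"
    and omit: "\<And>n z. z \<in> S \<Longrightarrow> f n z \<noteq> \<alpha> \<and> f n z \<noteq> \<beta>"
  obtains r g where "strict_mono (r :: nat \<Rightarrow> nat)"
    "\<And>K. compact K \<Longrightarrow> K \<subseteq> S \<Longrightarrow> uniform_limit K (\<lambda>n z. Fin (f (r n) z)) g sequentially"
proof (cases "S = {}")
  case True
  show thesis
    by (rule that[OF strict_mono_id]) (use True in auto)
next
  case False
  then obtain w where w: "w \<in> S" by blast
  define h where "h n z = (f n z - \<alpha>) / (\<beta> - \<alpha>)" for n z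
  have hol': "h n holomorphic_on S" "(\<lambda>z. inverse (h n z)) holomorphic_on S" for n
    unfolding h_def using omit \<open>\<alpha> \<noteq> \<beta>\<close> by (auto intro!: holomorphic_intros hol)
  have omit': "h n z \<noteq> 0 \<and> h n z \<noteq> 1" if "z \<in> S" for n z
    using omit[OF that, of n] \<open>\<alpha> \<noteq> \<beta>\<close> by (auto simp: h_def)
  define T where "T x = (case x of Fin z \<Rightarrow> Fin (\<alpha> + (\<beta> - \<alpha>) * z) | Infty \<Rightarrow> Infty)" for x
  interpret T: rational_sphere_map "[:\<alpha>, \<beta> - \<alpha>:]" 1 T
    by standard (use \<open>\<alpha> \<noteq> \<beta>\<close> in \<open>auto simp: T_def mult.commute\<close>)
  have fT: "Fin (f n z) = T (Fin (h n z))" for n z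
    using \<open>\<alpha> \<noteq> \<beta>\<close> by (simp add: T_def h_def)
  obtain r g where r: "strict_mono (r :: nat \<Rightarrow> nat)"
    and lim: "\<And>K. compact K \<Longrightarrow> K \<subseteq> S \<Longrightarrow>
      uniform_limit K (\<lambda>n z. Fin (h (r n) z)) g sequentially"
  proof (cases "infinite {n. cmod (h n w) \<le> 1}")
    case True
    show thesis
    proof (rule Montel_bounded_at_point[of S w h, OF S w hol'(1) omit' True])
      fix r :: "nat \<Rightarrow> nat" and g
      assume r: "strict_mono r"
        and l: "\<And>K. compact K \<Longrightarrow> K \<subseteq> S \<Longrightarrow> uniform_limit K (\<lambda>n. h (r n)) g sequentially"
      show thesis
        by (rule that[OF r uniform_limit_Fin[OF l]])
    qed
  next
    case False
    have inf: "infinite {n. cmod (inverse (h n w)) \<le> 1}"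
    proof
      assume "finite {n. cmod (inverse (h n w)) \<le> 1}"
      with False have "finite ({n. cmod (h n w) \<le> 1} \<union> {n. cmod (inverse (h n w)) \<le> 1})"
        by simp
      moreover have "{n. cmod (h n w) \<le> 1} \<union> {n. cmod (inverse (h n w)) \<le> 1} = UNIV"
        using omit'[OF w] by (auto simp: norm_inverse inverse_le_1_iff)
      ultimately show False
        by simp
    qed
    have omit_inv: "inverse (h n z) \<noteq> 0 \<and> inverse (h n z) \<noteq> 1" if "z \<in> S" for n z
      using omit'[OF that, of n] by simp
    show thesis
    proof (rule Montel_bounded_at_point[of S w "\<lambda>n z. inverse (h n z)", OF S w hol'(2) omit_inv inf])
      fix r :: "nat \<Rightarrow> nat" and g
      assume r: "strict_mono r"
        and rg: "\<And>K. compact K \<Longrightarrow> K \<subseteq> S \<Longrightarrow>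
          uniform_limit K (\<lambda>n z. inverse (h (r n) z)) g sequentially"
      have lim': "uniform_limit K (\<lambda>n z. Fin (h (r n) z)) (\<lambda>z. sphere_inverse (Fin (g z))) sequentially"
        if "compact K" "K \<subseteq> S" for K
      proof -
        have "uniform_limit K (\<lambda>n z. sphere_inverse (Fin (inverse (h (r n) z))))
            (\<lambda>z. sphere_inverse (Fin (g z))) sequentially"
          by (rule uniform_limit_sphere_compose[OF continuous_on_sphere_inverse
                uniform_limit_Fin[OF rg[OF that]]])
        then show ?thesis
          by (rule uniform_limit_cong'[THEN iffD1, rotated 2])
            (use omit' that in \<open>auto simp: subset_iff\<close>)
      qed
      show thesis
        by (rule that[OF r lim'])
    qed
  qed
  show thesis
  proof (rule that[OF r])
    show "uniform_limit K (\<lambda>n z. Fin (f (r n) z)) (\<lambda>z. T (g z)) sequentially"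
      if "compact K" "K \<subseteq> S" for K
      unfolding fT by (rule uniform_limit_sphere_compose[OF T.continuous_C lim[OF that]])
  qed
qed

section \<open>Surrounding compact sets\<close>

lemma not_inside_unbounded_connected:
  assumes "connected K" "\<not> bounded K" "p \<in> K" "K \<inter> T = {}"
  shows "p \<notin> inside T"
proof
  assume "p \<in> inside T"
  then have "bounded (connected_component_set (- T) p)"
    by (simp add: inside_def)
  moreover have "K \<subseteq> connected_component_set (- T) p"
    by (rule connected_component_maximal) (use assms in auto)
  ultimately show False
    using assms(2) bounded_subset by blast
qed

text \<open>Otherwise \<open>h z\<close> lies in an unbounded connected set \<open>G\<close> off
  \<open>h\<close> T\<open>. As the frontier of\<close>S\<open>is mapped into\<close>h
  \<open>T\<close>, the sets \<open>h\<close> S\<open>and\<close>h \<open>closure S\<close> meet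
  \<open>G\<close> in the same set, which is open and closed in \<open>G\<close>. So
  \<open>G\<close> lies in a compact set, a contradiction.\<close>

lemma holomorphic_image_inside:
  assumes S: "open S" "connected S" "bounded S" "z \<in> S" and fr: "frontier S \<subseteq> T"
    and hol: "h holomorphic_on S" and cont: "continuous_on (closure S) h"
    and z: "h z \<notin> h ` T"
  shows "h z \<in> inside (h ` T)"
proof (rule ccontr)
  assume "h z \<notin> inside (h ` T)"
  define G where "G = connected_component_set (- h ` T) (h z)"
  have zG: "h z \<in> G" and "connected G" and GT: "G \<subseteq> - h ` T"
    using z by (auto simp: G_def connected_component_subset)
  have unb: "\<not> bounded G"
    using \<open>h z \<notin> inside (h ` T)\<close> z by (simp add: G_def inside_def)
  have "S \<noteq> UNIV"
    using S(3) not_bounded_UNIV by blast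
  then obtain t where t: "t \<in> frontier S"
    using frontier_not_empty[of S] S(4) by blast
  have "\<not> h constant_on S"
  proof
    assume "h constant_on S"
    then have "h x = h z" if "x \<in> S" for x
      using that S(4) by (auto simp: constant_on_def)
    moreover have "t \<in> closure S"
      using t by (simp add: frontier_def)
    ultimately have "h t = h z"
      using continuous_constant_on_closure[OF cont, of "h z" t] by blast
    then show False
      using t fr z by (metis image_eqI subsetD)
  qed
  then have op: "open (h ` S)"
    using open_mapping_thm[OF hol S(1,2) S(1)] by blast
  have comp: "compact (h ` closure S)"
    by (intro compact_continuous_image cont) (simp add: S(3))
  have "closure S \<subseteq> S \<union> T"
    using fr closure_Un_frontier by blast
  then have "G \<subseteq> h ` S \<union> - h ` closure S"
    using GT by blast
  moreover have "h ` S \<inter> - h ` closure S \<inter> G = {}"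
    using closure_subset by blast
  ultimately have "- h ` closure S \<inter> G = {}"
    using connectedD[OF \<open>connected G\<close> op, of "- h ` closure S"] comp zG S(4)
    by (metis Compl_eq_Diff_UNIV IntI closed_Compl compact_imp_closed emptyE image_eqI open_Compl)
  then show False
    using unb bounded_subset[OF compact_imp_bounded[OF comp]] by blast
qed

context rational_sphere_map
begin

text \<open>
  Around a point of the Julia set the iterates cannot all avoid \<open>Infty\<close>, by Montel's criterion.
  At the first iterate that hits \<open>Infty\<close>, the previous one is holomorphic inside \<open>T\<close>, and by the
  open mapping theorem it keeps the inside of \<open>T\<close> inside the image of \<open>T\<close>.
\<close>

lemma iterate_surrounds_pole:
  assumes Infty: "Infty \<notin> fatou_set C"
    and \<alpha>\<beta>: "poly Q \<alpha> = 0" "poly Q \<beta> = 0" "\<alpha> \<noteq> \<beta>"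
    and T: "compact T" "connected T" "Fin ` T \<subseteq> fatou_set C"
    and a: "a \<in> inside T" "Fin a \<notin> fatou_set C"
  obtains m T' p where "Fin ` T' = (C ^^ m) ` Fin ` T" "Fin ` T' \<subseteq> fatou_set C"
    "compact T'" "connected T'" "poly Q p = 0" "p \<in> inside T'"
proof -
  \<comment> \<open>A single complementary component, rather than all of \<open>inside T\<close>, is
    connected, as Montel's criterion and the open mapping theorem require.\<close>
  define S where "S = connected_component_set (- T) a"
  have S: "open S" "connected S" "bounded S" "a \<in> S"
    using a(1) T(1) by (auto simp: S_def inside_def compact_imp_closed intro!: open_connected_component)
  have fr: "frontier S \<subseteq> T"
    using frontier_of_connected_component_subset[of "- T" a] T(1)
    by (simp add: S_def) (metis compact_imp_closed frontier_subset_closed subset_trans)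
  have "\<exists>n. \<exists>z\<in>S. (C ^^ n) (Fin z) = Infty"
  proof (rule ccontr)
    assume "\<not> (\<exists>n. \<exists>z\<in>S. (C ^^ n) (Fin z) = Infty)"
    then have fin: "\<And>n z. z \<in> S \<Longrightarrow> (C ^^ n) (Fin z) \<noteq> Infty"
      by blast
    have "normal_family_on (Fin ` S) {C ^^ n | n. n > 0}"
      unfolding normal_family_on_def
    proof (intro allI impI)
      fix F :: "nat \<Rightarrow> riemann_sphere \<Rightarrow> riemann_sphere"
      assume "range F \<subseteq> {C ^^ n | n. n > 0}"
      then have "\<forall>i. \<exists>n. F i = C ^^ n"
        by auto
      then obtain k where k: "\<And>i. F i = C ^^ k i"
        by metis
      define f where "f i z = finite_part (F i (Fin z))" for i z
      have f: "F i (Fin z) = Fin (f i z)" if "z \<in> S" for i z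
        using fin[OF that] by (simp add: f_def k)
      \<comment> \<open>A pole taken as a value would send the next iterate to \<open>Infty\<close>;
        thus \<open>\<alpha>\<close> and \<open>\<beta>\<close> are omitted.\<close>
      have omit: "f i z \<noteq> \<gamma>" if "z \<in> S" "poly Q \<gamma> = 0" for i z \<gamma>
      proof
        assume "f i z = \<gamma>"
        then have "(C ^^ Suc (k i)) (Fin z) = Infty"
          using f[OF that(1), of i] that(2) by (simp add: k C_Fin)
        then show False
          using fin[OF that(1)] by blast
      qed
      have hol: "f i holomorphic_on S" for i
        unfolding f_def k by (intro holomorphic_iterate fin)
      show "\<exists>r g. strict_mono r \<and> (\<forall>K. compact K \<and> K \<subseteq> Fin ` S \<longrightarrow>
          uniform_limit K (\<lambda>n. F (r n)) g sequentially)"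
      proof (rule Montel_omitted_values[OF S(1,2) \<alpha>\<beta>(3) hol])
        show "f i z \<noteq> \<alpha> \<and> f i z \<noteq> \<beta>" if "z \<in> S" for i z
          using omit[OF that] \<alpha>\<beta> by blast
        fix r :: "nat \<Rightarrow> nat" and g
        assume r: "strict_mono r"
          and rg: "\<And>K. compact K \<Longrightarrow> K \<subseteq> S \<Longrightarrow>
            uniform_limit K (\<lambda>n z. Fin (f (r n) z)) g sequentially"
        have "uniform_limit K (\<lambda>n. F (r n)) (\<lambda>x. g (finite_part x)) sequentially"
          if K: "compact K" "K \<subseteq> Fin ` S" for K
        proof -
          have "compact (finite_part ` K)"
            by (intro compact_continuous_image continuous_on_finite_part K) (use K in auto)
          moreover have "finite_part ` K \<subseteq> S"
            using K(2) by auto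
          ultimately have u: "uniform_limit (finite_part ` K) (\<lambda>n z. Fin (f (r n) z)) g sequentially"
            by (rule rg)
          show ?thesis
          proof (rule uniform_limitI)
            fix e :: real assume "e > 0"
            from uniform_limitD[OF u this]
            show "\<forall>\<^sub>F n in sequentially. \<forall>x\<in>K. dist (F (r n) x) (g (finite_part x)) < e"
              by eventually_elim (use K(2) f in fastforce)
          qed
        qed
        then show "\<exists>r g. strict_mono r \<and> (\<forall>K. compact K \<and> K \<subseteq> Fin ` S \<longrightarrow>
            uniform_limit K (\<lambda>n. F (r n)) g sequentially)"
          using r by blast
      qed
    qed
    then have "Fin a \<in> fatou_set C"
      using open_Fin_image[OF S(1)] S(4) unfolding fatou_set_def by blast
    with a(2) show False ..
  qed
  then obtain n where n: "\<exists>z\<in>S. (C ^^ n) (Fin z) = Infty"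
    and least: "\<And>k. k < n \<Longrightarrow> \<not> (\<exists>z\<in>S. (C ^^ k) (Fin z) = Infty)"
    using exists_least_iff[of "\<lambda>n. \<exists>z\<in>S. (C ^^ n) (Fin z) = Infty"] by blast
  obtain m where m: "n = Suc m"
    using n by (cases n) auto
  obtain z where z: "z \<in> S" "(C ^^ Suc m) (Fin z) = Infty"
    using n m by blast
  define h where "h z = finite_part ((C ^^ m) (Fin z))" for z
  have fatou: "(C ^^ m) (Fin t) \<in> fatou_set C" if "t \<in> T" for t
    using fatou_forward[OF Infty] T(3) that by blast
  \<comment> \<open>Finite on \<open>S\<close> because m < n, and on \<open>T\<close> because Fatou
    orbits never reach \<open>Infty\<close>.\<close>
  have fin: "(C ^^ m) (Fin t) \<noteq> Infty" if "t \<in> S \<union> T" for t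
    using that fatou[of t] least[of m] m Infty by fastforce
  have h: "Fin (h t) = (C ^^ m) (Fin t)" if "t \<in> S \<union> T" for t
    using fin[OF that] by (simp add: h_def)
  have cont: "continuous_on (S \<union> T) h"
    unfolding h_def
  proof (rule continuous_on_compose2[OF continuous_on_finite_part])
    show "Infty \<notin> (\<lambda>t. (C ^^ m) (Fin t)) ` (S \<union> T)"
      using fin by fastforce
    show "continuous_on (S \<union> T) (\<lambda>t. (C ^^ m) (Fin t))"
      by (rule continuous_on_compose2[OF continuous_on_funpow[OF continuous_C] continuous_on_Fin])
        simp
  qed simp
  have hz: "poly Q (h z) = 0"
  proof -
    have "C (Fin (h z)) = Infty"
      using z h[of z] by simp
    then show ?thesis
      by (simp add: C_Fin split: if_splits)
  qed
  have cl: "closure S \<subseteq> S \<union> T"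
    using fr closure_Un_frontier by blast
  have "h z \<notin> h ` T"
  proof
    assume "h z \<in> h ` T"
    then obtain t where "t \<in> T" "h t = h z" by auto
    then have "Fin (h z) \<in> fatou_set C"
      using fatou h by force
    from fatou_forward[OF Infty this, of 1] show False
      using hz Infty by (simp add: C_Fin)
  qed
  moreover have "h holomorphic_on S"
    unfolding h_def[abs_def] by (rule holomorphic_iterate) (use fin in blast)
  ultimately have "h z \<in> inside (h ` T)"
    using holomorphic_image_inside[OF S(1-3) z(1) fr] continuous_on_subset[OF cont cl] by blast
  moreover have "Fin ` h ` T = (C ^^ m) ` Fin ` T"
    using h by (force simp: image_image)
  moreover have "Fin ` h ` T \<subseteq> fatou_set C"
    using h fatou by auto
  moreover have "compact (h ` T)" "connected (h ` T)"
    using T continuous_on_subset[OF cont, of T]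
    by (auto intro: compact_continuous_image connected_continuous_image)
  ultimately show thesis
    by (intro that[of "h ` T" m "h z"] hz)
qed

end

section \<open>Separating a piece of a disconnected closed set from infinity\<close>

lemma bounded_vimage_Fin:
  assumes "closed A" "Infty \<notin> A"
  shows "bounded (Fin -` A)"
proof -
  have "open ((\<lambda>w. sphere_inverse (Fin w)) -` (- A))"
    using assms(1)
    by (intro open_vimage continuous_on_compose2[OF continuous_on_sphere_inverse continuous_on_Fin])
      auto
  moreover have "0 \<in> (\<lambda>w. sphere_inverse (Fin w)) -` (- A)"
    using assms(2) by simp
  ultimately obtain e where e: "e > 0" "ball 0 e \<subseteq> (\<lambda>w. sphere_inverse (Fin w)) -` (- A)"
    using open_contains_ball by blast
  have "cmod z \<le> inverse e" if "Fin z \<in> A" for z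
  proof (rule ccontr)
    assume "\<not> cmod z \<le> inverse e"
    then have z: "inverse e < cmod z" "z \<noteq> 0"
      using e(1) by auto
    then have "cmod (inverse z) < e"
      using e(1) by (metis inverse_inverse_eq inverse_positive_iff_positive less_imp_inverse_less norm_inverse)
    then have "sphere_inverse (Fin (inverse z)) \<notin> A"
      using e(2) by (auto simp del: sphere_inverse.simps)
    then show False
      using that z by simp
  qed
  then show ?thesis
    by (auto simp: bounded_iff)
qed

text \<open>A separation of \<open>J\<close> has a piece away from \<open>Infty\<close>, whose trace
  on the plane is compact. The frontier of a thin neighbourhood of that trace avoids
  \<open>J\<close> and separates it from infinity. In the plane, if a closed set separates two
  points then one of its components already does, and this component is \<open>T\<close>.\<close>

lemma closed_disconnected_surrounded:
  assumes J: "closed J" "Infty \<in> J" "\<not> connected J"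
  obtains T a where "compact T" "connected T" "Fin ` T \<subseteq> - J" "a \<in> inside T" "Fin a \<in> J"
proof -
  obtain A' B' where AB': "closed A'" "closed B'" "J \<subseteq> A' \<union> B'" "A' \<inter> B' \<inter> J = {}"
    "A' \<inter> J \<noteq> {}" "B' \<inter> J \<noteq> {}"
    using J(3) unfolding connected_closed by auto
  define A B where "A = (if Infty \<in> B' then A' else B')" and "B = (if Infty \<in> B' then B' else A')"
  have AB: "closed A" "closed B" "J \<subseteq> A \<union> B" "A \<inter> B \<inter> J = {}" "A \<inter> J \<noteq> {}" "Infty \<in> B"
    using AB' J(2) by (auto simp: A_def B_def)
  define K1 K2 where "K1 = Fin -` (A \<inter> J)" and "K2 = Fin -` (B \<inter> J)"
  have closed: "closed K1" "closed K2"
    unfolding K1_def K2_def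
    by (intro closed_vimage continuous_on_Fin closed_Int AB J)+
  have "Infty \<notin> A"
    using AB J by blast
  then have "bounded K1"
    unfolding K1_def by (intro bounded_vimage_Fin closed_Int AB J) auto
  with closed have "compact K1"
    by (simp add: compact_eq_bounded_closed)
  moreover have "K1 \<inter> K2 = {}"
    using AB(4) by (auto simp: K1_def K2_def)
  ultimately obtain d where d: "d > 0" "\<And>x y. x \<in> K1 \<Longrightarrow> y \<in> K2 \<Longrightarrow> d \<le> dist x y"
    using separate_compact_closed[of K1 K2] closed by blast
  obtain x where "x \<in> A \<inter> J"
    using AB(5) by blast
  then obtain a where a: "a \<in> K1"
    using \<open>Infty \<notin> A\<close> by (cases x) (auto simp: K1_def)
  \<comment> \<open>Radius d/2 keeps even the closure of \<open>V\<close> away from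
    \<open>K2\<close>.\<close>
  define V where "V = (\<Union>x\<in>K1. ball x (d / 2))"
  have V: "open V" "K1 \<subseteq> V"
    using d(1) by (auto simp: V_def)
  have "bounded V"
  proof -
    obtain R where R: "\<And>x. x \<in> K1 \<Longrightarrow> cmod x \<le> R"
      using \<open>bounded K1\<close> by (auto simp: bounded_iff)
    have "cmod y \<le> R + d / 2" if y: "y \<in> V" for y
    proof -
      obtain x where "x \<in> K1" "dist x y < d / 2"
        using y by (auto simp: V_def)
      then show ?thesis
        using R[of x] norm_triangle_sub[of y x] by (simp add: dist_norm norm_minus_commute)
    qed
    then show ?thesis
      by (auto simp: bounded_iff)
  qed
  have frK2: "y \<notin> closure V" if "y \<in> K2" for y
  proof
    assume "y \<in> closure V"
    then obtain v where v: "v \<in> V" "dist v y < d / 2"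
      using d(1) by (metis closure_approachable half_gt_zero)
    then obtain x where "x \<in> K1" "dist x v < d / 2"
      by (auto simp: V_def)
    then show False
      using d(2)[of x y] v(2) that dist_triangle[of x y v] by linarith
  qed
  have fr: "Fin ` frontier V \<subseteq> - J"
  proof safe
    fix v assume v: "v \<in> frontier V" "Fin v \<in> J"
    then have "v \<in> K1 \<union> K2"
      using AB(3) by (auto simp: K1_def K2_def)
    then show False
      using v(1) V frK2 by (auto simp: frontier_def interior_open)
  qed
  have "compact (frontier V)"
    using \<open>bounded V\<close> by (simp add: compact_frontier_bounded)
  then obtain R where R: "frontier V \<subseteq> ball 0 R" "V \<subseteq> ball 0 R"
    by (metis \<open>bounded V\<close> bounded_Un bounded_subset_ballD compact_imp_bounded le_sup_iff)
  \<comment> \<open>A representative of infinity: \<open>b\<close> lies off a disc containing the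
    frontier of \<open>V\<close>, hence outside every component of that frontier.\<close>
  define b where "b = complex_of_real R"
  have b: "b \<notin> ball 0 R"
    by (simp add: b_def)
  have "\<not> connected_component (- frontier V) a b"
  proof
    assume "connected_component (- frontier V) a b"
    then obtain S where S: "connected S" "S \<subseteq> - frontier V" "a \<in> S" "b \<in> S"
      by (auto simp: connected_component_def)
    then show False
      using connected_Int_frontier[of S V] a V(2) b R(2) by blast
  qed
  then obtain T where T: "T \<in> components (frontier V)" "\<not> connected_component (- T) a b"
    using separation_by_component_closed_pointwise[OF frontier_closed] by blast
  have TV: "T \<subseteq> frontier V"
    using T(1) in_components_subset by blast
  have "compact T"
    using compact_components[OF \<open>compact (frontier V)\<close> T(1)] .
  have "a \<notin> T"
    using a V TV by (auto simp: frontier_def interior_open)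
  have "b \<in> outside T"
    using convex_in_outside[OF convex_ball b] outside_mono[of T "ball 0 R"] TV R(1) by blast
  have "a \<in> inside T"
  proof (rule ccontr)
    assume "a \<notin> inside T"
    then have "a \<in> outside T"
      using \<open>a \<notin> T\<close> inside_Un_outside[of T] by blast
    moreover have "connected (outside T)"
      using connected_outside[of T] \<open>compact T\<close> compact_imp_bounded by auto
    ultimately have "connected_component (- T) a b"
      using \<open>b \<in> outside T\<close> outside_no_overlap[of T] unfolding connected_component_def by blast
    with T(2) show False ..
  qed
  then show thesis
    using that[of T a] \<open>compact T\<close> in_components_connected[OF T(1)] TV fr a
    by (auto simp: K1_def)
qed

section \<open>Dynamics on the imaginary axis\<close>

text \<open>With L = q q''/q'^2 the derivative is L^2 (3 - q' q'''/q''^2) / 2 wherever q'' \<noteq>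
  0. The general field serves twice: the complex case gives derivative 0 at the roots, the real case
  expansion on the imaginary axis.\<close>

lemma chebyshev_step_has_derivative:
  fixes q q1 q2 :: "'a::real_normed_field \<Rightarrow> 'a"
  assumes "(q has_field_derivative q1 y) (at y)" "(q1 has_field_derivative q2 y) (at y)"
    "(q2 has_field_derivative d) (at y)" "q1 y \<noteq> 0"
  shows "((\<lambda>y. y - q y / q1 y - (q y)\<^sup>2 * q2 y / (2 * q1 y ^ 3)) has_field_derivative
    (q y)\<^sup>2 * (3 * (q2 y)\<^sup>2 - q1 y * d) / (2 * q1 y ^ 4)) (at y)"
proof -
  define A B C where "A = q y" and "B = q1 y" and "C = q2 y"
  have B: "B \<noteq> 0"
    using assms(4) by (simp add: B_def)
  have "((\<lambda>y. y - q y / q1 y - (q y)\<^sup>2 * q2 y / (2 * q1 y ^ 3)) has_field_derivative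
    1 - (B * B - A * C) / (B * B)
      - ((2 * A * B * C + A\<^sup>2 * d) * (2 * B ^ 3) - A\<^sup>2 * C * (2 * (3 * B\<^sup>2 * C)))
        / (2 * B ^ 3 * (2 * B ^ 3))) (at y)"
    unfolding A_def B_def C_def
    by (rule derivative_eq_intros assms refl | use assms(4) in simp)+
  also have "1 - (B * B - A * C) / (B * B)
      - ((2 * A * B * C + A\<^sup>2 * d) * (2 * B ^ 3) - A\<^sup>2 * C * (2 * (3 * B\<^sup>2 * C)))
        / (2 * B ^ 3 * (2 * B ^ 3)) = A\<^sup>2 * (3 * C\<^sup>2 - B * d) / (2 * B ^ 4)"
    using B by (simp add: field_simps power2_eq_square power3_eq_cube power4_eq_xxxx)
  finally show ?thesis
    by (simp add: A_def B_def C_def)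
qed

locale imaginary_axis =
  fixes b c :: real
  assumes b_pos: "0 < b" and c_pos: "0 < c" and c_def: "c = 1 - b"
begin

text \<open>
  With \<open>p\<close> the quartic, \<open>q y = p (\<i> * y)\<close>; Chebyshev's method commutes with the rotation, so on the
  imaginary axis the method of \<open>p\<close> is the method \<open>g\<close> of \<open>q\<close>.
\<close>

definition q :: "real \<Rightarrow> real" where "q y = y ^ 4 + c * y\<^sup>2 - b"
definition q1 :: "real \<Rightarrow> real" where "q1 y = 4 * y ^ 3 + 2 * c * y"
definition q2 :: "real \<Rightarrow> real" where "q2 y = 12 * y\<^sup>2 + 2 * c"
definition g :: "real \<Rightarrow> real" where "g y = y - q y / q1 y - (q y)\<^sup>2 * q2 y / (2 * q1 y ^ 3)"
text \<open>With L = q q''/q'^2 this is q'^2 (L + 2) at nonzero points. Its zeros are the nonzero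
  fixed points of \<open>g\<close> that are not roots of \<open>q\<close>.\<close>

definition G :: "real \<Rightarrow> real" where "G y = q y * q2 y + 2 * (q1 y)\<^sup>2"

lemma q_factor: "q y = (y\<^sup>2 + 1) * (y\<^sup>2 - b)"
  unfolding q_def using c_def by algebra

lemma q2_pos: "q2 y > 0"
  using c_pos by (simp add: q2_def add_nonneg_pos)

lemma q1_factor: "q1 y = 2 * y * (2 * y\<^sup>2 + c)"
  by (simp add: q1_def algebra_simps power2_eq_square power3_eq_cube)

lemma q1_pos: "y > 0 \<Longrightarrow> q1 y > 0"
  using c_pos by (simp add: q1_factor add_nonneg_pos)

lemma q1_minus: "q1 (- y) = - q1 y"
  by (simp add: q1_def)

lemma q1_nonzero: "y \<noteq> 0 \<Longrightarrow> q1 y \<noteq> 0"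
  using q1_pos[of y] q1_pos[of "- y"] by (cases "y > 0") (auto simp: q1_minus)

lemma q_sign: "y > 0 \<Longrightarrow> q y > 0 \<longleftrightarrow> y > sqrt b" "y > 0 \<Longrightarrow> q y < 0 \<longleftrightarrow> y < sqrt b"
  "y > 0 \<Longrightarrow> q y = 0 \<longleftrightarrow> y = sqrt b"
proof -
  assume "y > 0"
  have 1: "y\<^sup>2 + 1 > 0"
    by (simp add: add_nonneg_pos)
  have "sqrt b < y \<longleftrightarrow> b < y\<^sup>2"
    using \<open>y > 0\<close> by (metis abs_of_pos real_sqrt_abs real_sqrt_less_iff)
  moreover have "y < sqrt b \<longleftrightarrow> y\<^sup>2 < b"
    using \<open>y > 0\<close> by (metis abs_of_pos real_sqrt_abs real_sqrt_less_iff)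
  moreover have "y = sqrt b \<longleftrightarrow> y\<^sup>2 = b"
    using \<open>y > 0\<close> b_pos by (metis abs_of_pos real_sqrt_abs real_sqrt_pow2 less_imp_le)
  ultimately show "q y > 0 \<longleftrightarrow> y > sqrt b" "q y < 0 \<longleftrightarrow> y < sqrt b" "q y = 0 \<longleftrightarrow> y = sqrt b"
    using 1 by (auto simp: q_factor zero_less_mult_iff mult_less_0_iff)
qed

lemma g_has_derivative:
  assumes "y \<noteq> 0"
  shows "(g has_real_derivative (q y)\<^sup>2 * (3 * (q2 y)\<^sup>2 - q1 y * (24 * y)) / (2 * q1 y ^ 4)) (at y)"
  unfolding g_def[abs_def]
  by (rule chebyshev_step_has_derivative)
    (auto simp: q_def[abs_def] q1_def[abs_def] q2_def[abs_def] q1_nonzero[OF assms, unfolded q1_def]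
      intro!: derivative_eq_intros)

lemma isCont_g: "y \<noteq> 0 \<Longrightarrow> isCont g y"
  using DERIV_isCont g_has_derivative by blast

text \<open>The terms in c y^2 of q''^2 and q' q''' cancel, leaving 48 y^4 + 4 c^2. Hence the
  derivative of \<open>g\<close> is at least L^2, which yields both monotonicity and
  expansion.\<close>

lemma curvature: "3 * (q2 y)\<^sup>2 - q1 y * (24 * y) \<ge> 2 * (q2 y)\<^sup>2"
proof -
  have "(q2 y)\<^sup>2 - q1 y * (24 * y) = 48 * (y\<^sup>2)\<^sup>2 + 4 * c\<^sup>2"
    by (simp add: q1_def q2_def algebra_simps power2_eq_square power3_eq_cube)
  also have "\<dots> \<ge> 0"
    by simp
  finally show ?thesis
    by simp
qed

lemma g_mono:
  assumes "0 < x" "x \<le> y"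
  shows "g x \<le> g y"
proof (rule DERIV_nonneg_imp_nondecreasing[OF assms(2)])
  fix t assume "x \<le> t" "t \<le> y"
  then have t: "t \<noteq> 0"
    using assms by auto
  have "0 \<le> 3 * (q2 t)\<^sup>2 - q1 t * (24 * t)"
    by (rule order_trans[OF _ curvature]) simp
  then have "(q t)\<^sup>2 * (3 * (q2 t)\<^sup>2 - q1 t * (24 * t)) / (2 * q1 t ^ 4) \<ge> 0"
    by (intro divide_nonneg_nonneg mult_nonneg_nonneg zero_le_power2) (simp_all add: zero_le_even_power)
  then show "\<exists>d. DERIV g t :> d \<and> d \<ge> 0"
    using g_has_derivative[OF t] by blast
qed

text \<open>\<open>G\<close> is a cubic in y^2 whose linear coefficient may be negative. Dividing by
  y^2 turns that term into a constant, and the remaining terms of G(y)/y^2 increase with y > 0; the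
  identity below is this comparison with denominators cleared.\<close>

lemma G_mono:
  assumes "0 < x" "x \<le> y" "G x > 0"
  shows "G y > 0"
proof -
  have G: "G w = 44 * (w\<^sup>2) ^ 3 + 46 * c * (w\<^sup>2)\<^sup>2 + (10 * c\<^sup>2 - 12 * b) * w\<^sup>2 - 2 * b * c" for w
    by (simp add: G_def q_def q1_def q2_def algebra_simps power2_eq_square power3_eq_cube
        power4_eq_xxxx)
  define s t where "s = x\<^sup>2" and "t = y\<^sup>2"
  have st: "0 < s" "s \<le> t"
    using assms by (auto simp: s_def t_def power_mono)
  have "s * G y - t * G x = 44 * s * t * (t + s) * (t - s) + 46 * c * s * t * (t - s) + 2 * b * c * (t - s)"
    unfolding G s_def[symmetric] t_def[symmetric] by algebra
  also have "\<dots> \<ge> 0"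
    using st b_pos c_pos by (intro add_nonneg_nonneg mult_nonneg_nonneg) auto
  finally have "s * G y \<ge> t * G x"
    by simp
  moreover have "t * G x > 0"
    using st assms(3) by simp
  ultimately show ?thesis
    using st(1) by (smt (verit) zero_less_mult_pos)
qed

lemma g_diff: "y \<noteq> 0 \<Longrightarrow> g y - y = - (q y * G y) / (2 * q1 y ^ 3)"
  using q1_nonzero[of y]
  by (simp add: g_def G_def field_simps power2_eq_square power3_eq_cube)

lemma g_sqrt: "g (sqrt b) = sqrt b"
proof -
  have "q (sqrt b) = 0"
    using b_pos by (simp add: q_sign(3))
  then show ?thesis
    by (simp add: g_def)
qed

lemma g_funpow_minus: "(g ^^ n) (- y) = - (g ^^ n) y"
proof (induction n)
  case (Suc n)
  have "g (- w) = - g w" for w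
  proof -
    have "q (- w) = q w" "q2 (- w) = q2 w"
      by (simp_all add: q_def q2_def)
    then show ?thesis
      by (simp add: g_def q1_minus)
  qed
  with Suc show ?case
    by simp
qed simp

text \<open>The iterates are monotone: above the root they decrease and stay above it, below the
  root they increase and stay below it. \<open>G_mono\<close> keeps \<open>G\<close> positive along
  the orbit and at the limit, so the limit is a fixed point of \<open>g\<close> with
  \<open>G\<close> positive, which must be the root.\<close>

lemma funpow_g_tendsto:
  assumes y: "y > 0" "G y > 0"
  shows "(\<lambda>n. (g ^^ n) y) \<longlonglongrightarrow> sqrt b" and "(g ^^ n) y > 0"
proof -
  have sq: "sqrt b > 0"
    using b_pos by simp
  have fixed: "L = sqrt b"
    if L: "(\<lambda>n. (g ^^ n) y) \<longlonglongrightarrow> L" "L > 0" "G L > 0" for L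
  proof -
    have "(\<lambda>n. g ((g ^^ n) y)) \<longlonglongrightarrow> g L"
      by (rule isCont_tendsto_compose[OF isCont_g L(1)]) (use L in simp)
    moreover have "(\<lambda>n. g ((g ^^ n) y)) \<longlonglongrightarrow> L"
      using LIMSEQ_Suc[OF L(1)] by simp
    ultimately have "g L - L = 0"
      using LIMSEQ_unique by fastforce
    then have "q L = 0"
      using g_diff[of L] q1_pos[of L] L by simp
    then show ?thesis
      using q_sign(3) L by blast
  qed
  have "(\<lambda>n. (g ^^ n) y) \<longlonglongrightarrow> sqrt b \<and> (\<forall>n. (g ^^ n) y > 0)"
  proof (cases "y \<ge> sqrt b")
    case True
    have lb: "(g ^^ n) y \<ge> sqrt b" for n
    proof (induction n)
      case (Suc n)
      then show ?case
        using g_mono[OF sq Suc] g_sqrt by simp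
    qed (use True in simp)
    have "decseq (\<lambda>n. (g ^^ n) y)"
    proof (rule decseq_SucI)
      fix n
      define w where "w = (g ^^ n) y"
      have w: "w \<ge> sqrt b" "w > 0"
        using lb[of n] less_le_trans[OF sq lb] by (simp_all add: w_def)
      then have "q w \<ge> 0"
        using q_sign(2)[of w] by linarith
      then have "q w * G w / (2 * q1 w ^ 3) \<ge> 0"
        using q1_pos[OF w(2)] q2_pos[of w] by (simp add: G_def)
      then have "g w \<le> w"
        using g_diff[of w] w by simp
      then show "(g ^^ Suc n) y \<le> (g ^^ n) y"
        by (simp add: w_def)
    qed
    then obtain L where L: "(\<lambda>n. (g ^^ n) y) \<longlonglongrightarrow> L"
      using decseq_convergent lb by metis
    have "L \<ge> sqrt b"
      using LIMSEQ_le_const[OF L] lb by blast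
    moreover have "G (sqrt b) > 0"
      using q_sign(3)[OF sq] q1_pos[OF sq] by (simp add: G_def)
    ultimately have "L = sqrt b"
      using fixed[OF L] G_mono[OF sq] sq by fastforce
    then show ?thesis
      using L less_le_trans[OF sq lb] by blast
  next
    case False
    have inv: "y \<le> (g ^^ n) y \<and> (g ^^ n) y \<le> sqrt b \<and> (g ^^ n) y \<le> (g ^^ Suc n) y" for n
    proof (induction n)
      case 0
      have "q y * G y / (2 * q1 y ^ 3) \<le> 0"
        using q_sign(2)[OF y(1)] False y q1_pos[OF y(1)]
        by (simp add: divide_nonpos_pos mult_nonpos_nonneg)
      then show ?case
        using g_diff[of y] False y by simp
    next
      case (Suc n)
      define w where "w = (g ^^ Suc n) y"
      have w: "y \<le> w" "w > 0" "w \<le> sqrt b"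
        using Suc y g_mono[of "(g ^^ n) y" "sqrt b"] g_sqrt by (auto simp: w_def)
      have "G w > 0"
        using G_mono[OF y(1) w(1) y(2)] .
      moreover have "q w \<le> 0"
        using q_sign(1)[OF w(2)] w(3) by linarith
      ultimately have "q w * G w / (2 * q1 w ^ 3) \<le> 0"
        using q1_pos[OF w(2)] by (simp add: divide_nonpos_pos mult_nonpos_nonneg)
      then have "w \<le> g w"
        using g_diff[of w] w by simp
      then show ?case
        using w by (simp add: w_def)
    qed
    then have "incseq (\<lambda>n. (g ^^ n) y)"
      by (intro incseq_SucI) blast
    then obtain L where L: "(\<lambda>n. (g ^^ n) y) \<longlonglongrightarrow> L"
      using incseq_convergent inv by metis
    have "L \<ge> y"
      using LIMSEQ_le_const[OF L] inv by blast
    then have "L = sqrt b"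
      using fixed[OF L] G_mono[OF y(1) _ y(2)] y by fastforce
    then show ?thesis
      using L less_le_trans[OF y(1)] inv by blast
  qed
  then show "(\<lambda>n. (g ^^ n) y) \<longlonglongrightarrow> sqrt b" "(g ^^ n) y > 0"
    by auto
qed

section \<open>Expansion of \<open>g\<close> where \<open>G\<close> is not positive\<close>

lemma G_nonpos_bound: "G y \<le> 0 \<Longrightarrow> \<bar>y\<bar> < sqrt b"
proof (rule ccontr)
  assume "G y \<le> 0" "\<not> \<bar>y\<bar> < sqrt b"
  have "b \<le> y\<^sup>2"
    using \<open>\<not> \<bar>y\<bar> < sqrt b\<close> b_pos
    by (metis abs_ge_zero linorder_not_less power2_abs power_mono real_sqrt_ge_0_iff real_sqrt_pow2 less_imp_le)
  then have "q y \<ge> 0"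
    by (simp add: q_factor)
  moreover have "y \<noteq> 0"
    using \<open>b \<le> y\<^sup>2\<close> b_pos by auto
  ultimately have "G y > 0"
    using q1_nonzero q2_pos[of y] by (simp add: G_def add_nonneg_pos)
  with \<open>G y \<le> 0\<close> show False by simp
qed

text \<open>\<open>G y \<le> 0\<close> says L \<le> -2, and by \<open>curvature\<close> the
  derivative is at least L^2.\<close>

lemma g_derivative_ge_4:
  assumes "y \<noteq> 0" "G y \<le> 0"
  shows "(q y)\<^sup>2 * (3 * (q2 y)\<^sup>2 - q1 y * (24 * y)) / (2 * q1 y ^ 4) \<ge> 4"
proof -
  have "2 * (q1 y)\<^sup>2 \<le> - (q y * q2 y)"
    using assms(2) by (simp add: G_def)
  then have "(2 * (q1 y)\<^sup>2)\<^sup>2 \<le> (- (q y * q2 y))\<^sup>2"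
    by (rule power_mono) simp
  then have "8 * q1 y ^ 4 \<le> (q y)\<^sup>2 * (2 * (q2 y)\<^sup>2)"
    by (simp add: power_mult_distrib mult.commute flip: power_mult)
  also have "\<dots> \<le> (q y)\<^sup>2 * (3 * (q2 y)\<^sup>2 - q1 y * (24 * y))"
    by (intro mult_left_mono curvature) simp
  finally have "8 * q1 y ^ 4 \<le> (q y)\<^sup>2 * (3 * (q2 y)\<^sup>2 - q1 y * (24 * y))" .
  moreover have "q1 y ^ 4 > 0"
    using q1_nonzero[OF assms(1)] by (simp add: zero_less_power_eq)
  ultimately show ?thesis
    by (simp add: pos_le_divide_eq)
qed

text \<open>If no point of the interval ever reached 0 or a point with \<open>G\<close> positive,
  each step would stretch a subinterval of the image by 4 (mean value theorem, then intermediate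
  value theorem), although all images stay within (-sqrt b, sqrt b). Hitting 0 is a separate outcome
  because continuity of \<open>g\<close> is available only off 0.\<close>

lemma expanding_interval:
  assumes "u < v"
  shows "\<exists>y\<in>{u..v}. \<exists>n. (g ^^ n) y = 0 \<or> G ((g ^^ n) y) > 0"
proof (rule ccontr)
  assume "\<not> ?thesis"
  then have stay: "(g ^^ n) y \<noteq> 0" "G ((g ^^ n) y) \<le> 0" if "y \<in> {u..v}" for n y
    using that by (auto simp: not_less)
  have "\<exists>u' v'. 4 ^ n * (v - u) \<le> v' - u' \<and> {u'..v'} \<subseteq> (g ^^ n) ` {u..v}" for n
  proof (induction n)
    case 0
    show ?case
      by (intro exI[of _ u] exI[of _ v]) auto
  next
    case (Suc n)
    then obtain u' v' where uv: "4 ^ n * (v - u) \<le> v' - u'" "{u'..v'} \<subseteq> (g ^^ n) ` {u..v}"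
      by blast
    have "0 < 4 ^ n * (v - u)"
      using assms by simp
    then have less: "u' < v'"
      using uv(1) by linarith
    have st: "x \<noteq> 0 \<and> G x \<le> 0" if "x \<in> {u'..v'}" for x
    proof -
      obtain y where "y \<in> {u..v}" "x = (g ^^ n) y"
        using uv(2) \<open>x \<in> {u'..v'}\<close> by blast
      then show ?thesis
        using stay by simp
    qed
    obtain \<xi> where \<xi>: "u' < \<xi>" "\<xi> < v'" "g v' - g u' = (v' - u') *
        ((q \<xi>)\<^sup>2 * (3 * (q2 \<xi>)\<^sup>2 - q1 \<xi> * (24 * \<xi>)) / (2 * q1 \<xi> ^ 4))"
      using MVT2[OF less, of g "\<lambda>y. (q y)\<^sup>2 * (3 * (q2 y)\<^sup>2 - q1 y * (24 * y)) / (2 * q1 y ^ 4)"]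
        g_has_derivative st by auto
    have "(v' - u') * 4 \<le> g v' - g u'"
      unfolding \<xi>(3) using less \<xi> st by (intro mult_left_mono g_derivative_ge_4) auto
    then have "4 ^ Suc n * (v - u) \<le> g v' - g u'"
      using uv(1) by simp
    moreover have "{g u'..g v'} \<subseteq> g ` {u'..v'}"
    proof
      fix w assume "w \<in> {g u'..g v'}"
      moreover have "continuous_on {u'..v'} g"
        using isCont_g st by (intro continuous_at_imp_continuous_on) blast
      ultimately show "w \<in> g ` {u'..v'}"
        using IVT'[of g u' w v'] less by force
    qed
    then have "{g u'..g v'} \<subseteq> (g ^^ Suc n) ` {u..v}"
      using uv(2) by (fastforce simp: image_comp)
    ultimately show ?case
      by blast
  qed
  \<comment> \<open>2 sqrt b is the length of the interval to which \<open>G_nonpos_bound\<close>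
    confines the images.\<close>
  moreover obtain n where n: "2 * sqrt b / (v - u) < 4 ^ n"
    using real_arch_pow[of 4] by auto
  ultimately obtain u' v' where uv: "4 ^ n * (v - u) \<le> v' - u'" "{u'..v'} \<subseteq> (g ^^ n) ` {u..v}"
    by blast
  have big: "2 * sqrt b < v' - u'"
    using n uv(1) assms by (simp add: pos_divide_less_eq)
  moreover have "sqrt b > 0"
    using b_pos by simp
  ultimately have "u' \<le> v'"
    by linarith
  then have "u' \<in> {u'..v'}" "v' \<in> {u'..v'}"
    by simp_all
  then have "\<bar>u'\<bar> < sqrt b" "\<bar>v'\<bar> < sqrt b"
    using subsetD[OF uv(2)] stay(2) G_nonpos_bound by (metis (no_types, lifting) imageE)+
  with big show False
    by linarith
qed

end

section \<open>Chebyshev's method of the quartic\<close>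

text \<open>\<open>quot_of_fract\<close> returns its own coprime pair, not \<open>P\<close> and
  \<open>Q\<close>. Cross multiplication shows that both pairs have the same poles, the same finite
  values and the same difference of degrees.\<close>

lemma rational_map_to_fract:
  fixes P Q :: "complex poly"
  assumes Q: "Q \<noteq> 0" and no_common_zero: "\<And>z. poly Q z = 0 \<Longrightarrow> poly P z \<noteq> 0"
  shows "rational_map (to_fract P / to_fract Q) (Fin z) =
      (if poly Q z = 0 then Infty else Fin (poly P z / poly Q z))"
    and "degree Q < degree P \<Longrightarrow> rational_map (to_fract P / to_fract Q) Infty = Infty"
proof -
  define R where "R = to_fract P / to_fract Q"
  obtain P1 Q1 where PQ: "quot_of_fract R = (P1, Q1)"
    by (cases "quot_of_fract R")
  have Q1: "Q1 \<noteq> 0"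
    using snd_quot_of_fract_nonzero[of R] PQ by simp
  have "Fract P1 Q1 = R"
    using Fract_quot_of_fract[of R] PQ by simp
  then have "Fract P1 Q1 = Fract P Q"
    by (simp add: R_def Fract_conv_to_fract)
  then have cross: "P1 * Q = P * Q1"
    using Q Q1 by (simp add: eq_fract)
  have cop: "coprime P1 Q1"
    using coprime_quot_of_fract[of R] PQ by simp
  have no_common_zero1: "poly P1 w \<noteq> 0" if "poly Q1 w = 0" for w
  proof
    assume "poly P1 w = 0"
    with that have "[:- w, 1:] dvd P1" "[:- w, 1:] dvd Q1"
      by (simp_all add: poly_eq_0_iff_dvd)
    with cop have "is_unit [:- w, 1:]"
      by (rule coprime_common_divisor)
    then show False
      by (simp add: is_unit_iff_degree)
  qed
  have crossz: "poly P1 z * poly Q z = poly P z * poly Q1 z"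
    using cross by (metis poly_mult)
  show "rational_map (to_fract P / to_fract Q) (Fin z) =
      (if poly Q z = 0 then Infty else Fin (poly P z / poly Q z))"
  proof (cases "poly Q z = 0")
    case True
    then have "poly Q1 z = 0"
      using crossz no_common_zero[OF True] by simp
    then show ?thesis
      using True PQ by (simp add: R_def)
  next
    case False
    then have "poly Q1 z \<noteq> 0"
      using crossz no_common_zero1[of z] by auto
    then show ?thesis
      using False PQ crossz by (simp add: R_def frac_eq_eq)
  qed
  show "rational_map (to_fract P / to_fract Q) Infty = Infty" if less: "degree Q < degree P"
  proof -
    have "P \<noteq> 0"
      using less by auto
    then have "P1 \<noteq> 0"
      using cross Q1 by (metis mult_eq_0_iff)
    then have "degree P1 + degree Q = degree P + degree Q1"
      using arg_cong[OF cross, of degree] Q Q1 \<open>P \<noteq> 0\<close> by (simp add: degree_mult_eq)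
    then show ?thesis
      using less PQ by (simp add: R_def)
  qed
qed

lemma chebyshev_fract_eq:
  assumes "pderiv p \<noteq> 0"
  shows "chebyshev_fract p =
    to_fract (2 * ([:0, 1:] * pderiv p ^ 3 - p * (pderiv p)\<^sup>2) - p\<^sup>2 * pderiv (pderiv p))
      / to_fract (2 * pderiv p ^ 3)"
proof -
  define x A B C where "x = to_fract [:0, 1 :: complex:]" and "A = to_fract p"
    and "B = to_fract (pderiv p)" and "C = to_fract (pderiv (pderiv p))"
  have B: "B \<noteq> 0"
    using assms by (simp add: B_def)
  have two: "to_fract (2 :: complex poly) = 2"
    by (metis one_add_one to_fract_1 to_fract_add)
  have "(2 :: complex poly fract) \<noteq> 0"
    using two by (metis to_fract_eq_0_iff zero_neq_numeral)
  have "chebyshev_fract p = x - (1 + 1 / 2 * (A * C / B\<^sup>2)) * (A / B)"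
    by (simp add: chebyshev_fract_def chebyshev_L_def x_def A_def B_def C_def)
  also have "\<dots> = (2 * (x * B ^ 3 - A * B\<^sup>2) - A\<^sup>2 * C) / (2 * B ^ 3)"
    using B \<open>2 \<noteq> 0\<close> by (simp add: field_simps power2_eq_square power3_eq_cube)
  also have "\<dots> = to_fract (2 * ([:0, 1:] * pderiv p ^ 3 - p * (pderiv p)\<^sup>2) - p\<^sup>2 * pderiv (pderiv p))
      / to_fract (2 * pderiv p ^ 3)"
    by (simp only: to_fract_diff to_fract_mult two power2_eq_square power3_eq_cube
        x_def A_def B_def C_def)
  finally show ?thesis .
qed

text \<open>A zero derivative makes the map contract distances to the fixed point by 1/2 on a small
  disc, so the iterates converge there at a uniform geometric rate.\<close>

lemma (in rational_sphere_map) superattracting_point: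
  assumes fixed: "poly P \<zeta> / poly Q \<zeta> = \<zeta>" and nz: "poly Q \<zeta> \<noteq> 0"
    and deriv: "((\<lambda>z. poly P z / poly Q z) has_field_derivative 0) (at \<zeta>)"
  obtains B where "attracting_point C (Fin \<zeta>) B"
proof -
  let ?f = "\<lambda>z. poly P z / poly Q z"
  have "\<forall>e>0. \<exists>d>0. \<forall>z. norm (z - \<zeta>) < d \<longrightarrow>
      norm (?f z - ?f \<zeta> - 0 * (z - \<zeta>)) \<le> e * norm (z - \<zeta>)"
    using deriv unfolding has_field_derivative_def has_derivative_at_alt by blast
  from this[rule_format, of "1 / 2"]
  obtain d1 where d1: "d1 > 0" "\<And>z. dist z \<zeta> < d1 \<Longrightarrow> dist (?f z) \<zeta> \<le> dist z \<zeta> / 2"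
    using fixed by (auto simp: dist_norm)
  have "open {z. poly Q z \<noteq> 0}"
    by (intro open_Collect_neq continuous_intros)
  then obtain d2 where d2: "d2 > 0" "ball \<zeta> d2 \<subseteq> {z. poly Q z \<noteq> 0}"
    using nz openE[of "{z. poly Q z \<noteq> 0}" \<zeta>] by blast
  define d where "d = min d1 d2"
  have d: "d > 0" "\<And>z. dist z \<zeta> < d \<Longrightarrow> poly Q z \<noteq> 0 \<and> dist (?f z) \<zeta> \<le> dist z \<zeta> / 2"
    using d1 d2 by (auto simp: d_def dist_commute subset_iff)
  have iter: "\<exists>w. (C ^^ n) (Fin z) = Fin w \<and> dist w \<zeta> \<le> (1 / 2) ^ n * dist z \<zeta>"
    if z: "dist z \<zeta> < d" for n z
  proof (induction n)
    case (Suc n)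
    then obtain w where w: "(C ^^ n) (Fin z) = Fin w" "dist w \<zeta> \<le> (1 / 2) ^ n * dist z \<zeta>"
      by blast
    have "(1 / 2) ^ n * dist z \<zeta> \<le> 1 * dist z \<zeta>"
      by (intro mult_right_mono power_le_one) auto
    then have "dist w \<zeta> < d"
      using w(2) z by linarith
    from d(2)[OF this] w show ?case
      by (auto simp: C_Fin)
  qed (auto intro: exI[of _ z])
  have "attracting_point C (Fin \<zeta>) (Fin ` ball \<zeta> d)"
  proof
    show "uniform_limit (Fin ` ball \<zeta> d) (\<lambda>n. C ^^ n) (\<lambda>_. Fin \<zeta>) sequentially"
    proof (rule uniform_limitI)
      fix e :: real assume "e > 0"
      have "(\<lambda>n. 2 * ((1 / 2 :: real) ^ n * d)) \<longlonglongrightarrow> 2 * (0 * d)"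
        by (intro tendsto_intros LIMSEQ_power_zero) simp
      from order_tendstoD(2)[OF this, of e]
      have "\<forall>\<^sub>F n in sequentially. 2 * ((1 / 2 :: real) ^ n * d) < e"
        using \<open>e > 0\<close> by simp
      then show "\<forall>\<^sub>F n in sequentially. \<forall>x\<in>Fin ` ball \<zeta> d. dist ((C ^^ n) x) (Fin \<zeta>) < e"
      proof eventually_elim
        case (elim n)
        have "dist ((C ^^ n) (Fin z)) (Fin \<zeta>) < e" if z: "dist z \<zeta> < d" for z
        proof -
          obtain w where w: "(C ^^ n) (Fin z) = Fin w" "dist w \<zeta> \<le> (1 / 2) ^ n * dist z \<zeta>"
            using iter[OF z] by blast
          have "dist w \<zeta> \<le> (1 / 2) ^ n * d"
            using w(2) z by (meson less_imp_le mult_left_mono order_trans zero_le_power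
                zero_le_divide_1_iff zero_le_numeral)
          then show ?thesis
            using elim dist_Fin_le[of w \<zeta>] w(1) by simp
        qed
        then show ?case
          by (auto simp: dist_commute)
      qed
    qed
  qed (auto simp: continuous_C d(1) intro!: open_Fin_image)
  then show thesis
    by (rule that)
qed

lemma quartic_eq: "quartic b = [:- of_real b, 0, of_real b - 1, 0, 1:]"
  by (simp add: quartic_def)

lemma pderiv_quartic: "pderiv (quartic b) = [:0, 2 * (of_real b - 1), 0, 4:]"
  by (simp add: quartic_eq pderiv_pCons)

lemma pderiv2_quartic: "pderiv (pderiv (quartic b)) = [:2 * (of_real b - 1), 0, 12:]"
  by (simp add: pderiv_quartic pderiv_pCons)

lemma poly_quartic: "poly (quartic b) z = (z\<^sup>2 - 1) * (z\<^sup>2 + of_real b)"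
  by (simp add: quartic_def power2_eq_square algebra_simps)

lemma poly_pderiv_quartic: "poly (pderiv (quartic b)) z = 2 * z * (2 * z\<^sup>2 - of_real (1 - b))"
  by (simp add: pderiv_quartic power2_eq_square algebra_simps)

lemma poly_pderiv2_quartic: "poly (pderiv (pderiv (quartic b))) z = 12 * z\<^sup>2 - 2 * of_real (1 - b)"
  by (simp add: pderiv2_quartic power2_eq_square algebra_simps)

locale quartic_chebyshev =
  fixes b :: real
  assumes b: "0 < b" "b < 1"
begin

definition p :: "complex poly" where "p = quartic b"

definition P :: "complex poly" where
  "P = 2 * ([:0, 1:] * pderiv p ^ 3 - p * (pderiv p)\<^sup>2) - p\<^sup>2 * pderiv (pderiv p)"

definition Q :: "complex poly" where "Q = 2 * pderiv p ^ 3"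

definition C :: "riemann_sphere \<Rightarrow> riemann_sphere" where "C = chebyshev p"

lemma poly_p: "poly p z = (z\<^sup>2 - 1) * (z\<^sup>2 + of_real b)"
  by (simp add: p_def poly_quartic)

lemma poly_p1: "poly (pderiv p) z = 2 * z * (2 * z\<^sup>2 - of_real (1 - b))"
  by (simp add: p_def poly_pderiv_quartic)

lemma poly_p2: "poly (pderiv (pderiv p)) z = 12 * z\<^sup>2 - 2 * of_real (1 - b)"
  by (simp add: p_def poly_pderiv2_quartic)

lemma poly_Q_eq_0_iff: "poly Q z = 0 \<longleftrightarrow> z = 0 \<or> z\<^sup>2 = of_real ((1 - b) / 2)"
proof -
  have "poly Q z = 0 \<longleftrightarrow> z = 0 \<or> 2 * z\<^sup>2 - of_real (1 - b) = 0"
    by (simp add: Q_def poly_p1)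
  moreover have "2 * z\<^sup>2 - of_real (1 - b) = 0 \<longleftrightarrow> z\<^sup>2 = of_real ((1 - b) / 2)"
    by (auto simp: field_simps)
  ultimately show ?thesis
    by simp
qed

text \<open>At a zero of p' the numerator reduces to -p^2 p''. The critical points of the quartic
  are simple and are not roots, so every zero of \<open>Q\<close> is a genuine pole.\<close>

lemma poly_P_nonzero:
  assumes "poly Q z = 0"
  shows "poly P z \<noteq> 0"
proof -
  have p1: "poly (pderiv p) z = 0"
    using assms by (simp add: Q_def)
  have nz: "of_real r \<noteq> (0 :: complex)" if "r \<noteq> 0" for r :: real
    using that by simp
  have "poly p z \<noteq> 0 \<and> poly (pderiv (pderiv p)) z \<noteq> 0"
  proof (cases "z = 0")
    case True
    then show ?thesis
      using b nz[of b] nz[of "1 - b"] by (simp add: poly_p poly_p2)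
  next
    case False
    then have z: "z\<^sup>2 = of_real ((1 - b) / 2)"
      using assms poly_Q_eq_0_iff by blast
    have "z\<^sup>2 - 1 = of_real ((1 - b) / 2 - 1)" "z\<^sup>2 + of_real b = of_real ((1 - b) / 2 + b)"
      "12 * z\<^sup>2 - 2 * of_real (1 - b) = of_real (12 * ((1 - b) / 2) - 2 * (1 - b))"
      by (simp_all add: z)
    moreover have "(1 - b) / 2 - 1 \<noteq> 0" "(1 - b) / 2 + b \<noteq> 0" "12 * ((1 - b) / 2) - 2 * (1 - b) \<noteq> 0"
      using b by (simp_all add: field_simps)
    ultimately show ?thesis
      by (simp only: poly_p poly_p2 mult_eq_0_iff of_real_eq_0_iff) simp
  qed
  then show ?thesis
    using p1 by (simp add: P_def)
qed

lemma degrees: "degree Q < degree P" "pderiv p \<noteq> 0" "Q \<noteq> 0"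
proof -
  have "degree (pderiv p) = 3 \<and> lead_coeff (pderiv p) = 4"
    unfolding p_def pderiv_quartic by simp
  moreover have "degree (pderiv (pderiv p)) = 2 \<and> lead_coeff (pderiv (pderiv p)) = 12"
    unfolding p_def pderiv2_quartic by simp
  moreover have "degree p = 4 \<and> lead_coeff p = 1"
    unfolding p_def quartic_eq by simp
  ultimately have deg: "degree p = 4" "degree (pderiv p) = 3" "degree (pderiv (pderiv p)) = 2"
    and lead: "lead_coeff p = 1" "lead_coeff (pderiv p) = 4" "lead_coeff (pderiv (pderiv p)) = 12"
    by blast+
  have nz: "p \<noteq> 0" "pderiv p \<noteq> 0" "pderiv (pderiv p) \<noteq> 0"
    using lead by auto
  then show "pderiv p \<noteq> 0" "Q \<noteq> 0"
    by (auto simp: Q_def)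
  have Qdeg: "degree Q = 9"
    using nz deg by (simp add: Q_def degree_mult_eq degree_power_eq)
  have 1: "coeff ([:0, 1:] * pderiv p ^ 3) 10 = 64"
  proof -
    have "degree (pderiv p ^ 3) = 9" "lead_coeff (pderiv p ^ 3) = 64"
      using nz deg lead lead_coeff_power[of "pderiv p" 3] by (simp_all add: degree_power_eq)
    then show ?thesis
      by (simp add: coeff_pCons numeral_eq_Suc)
  qed
  have 2: "coeff (p * (pderiv p)\<^sup>2) 10 = 16"
  proof -
    have "degree (p * (pderiv p)\<^sup>2) = 10" "lead_coeff (p * (pderiv p)\<^sup>2) = 16"
      using nz deg lead lead_coeff_mult[of p "(pderiv p)\<^sup>2"] lead_coeff_power[of "pderiv p" 2]
      by (simp_all add: degree_mult_eq degree_power_eq)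
    then show ?thesis
      by simp
  qed
  have 3: "coeff (p\<^sup>2 * pderiv (pderiv p)) 10 = 12"
  proof -
    have "degree (p\<^sup>2 * pderiv (pderiv p)) = 10" "lead_coeff (p\<^sup>2 * pderiv (pderiv p)) = 12"
      using nz deg lead lead_coeff_mult[of "p\<^sup>2" "pderiv (pderiv p)"] lead_coeff_power[of p 2]
      by (simp_all add: degree_mult_eq degree_power_eq)
    then show ?thesis
      by simp
  qed
  have dbl: "2 * q = smult 2 q" for q :: "complex poly"
    by (simp add: numeral_poly)
  \<comment> \<open>84 = 2 (64 - 16) - 12, from the three leading terms above.\<close>
  have "coeff P 10 = 84"
    by (simp add: P_def dbl 1 2 3 del: mult_pCons_left)
  then have "degree P \<ge> 10"
    by (intro le_degree) simp
  with Qdeg show "degree Q < degree P"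
    by simp
qed

lemma C_eq: "C = rational_map (to_fract P / to_fract Q)"
  by (simp only: C_def chebyshev_def chebyshev_fract_eq[OF degrees(2)] P_def Q_def)

sublocale rational_sphere_map P Q C
proof
  show "poly Q z = 0 \<Longrightarrow> poly P z \<noteq> 0" for z
    by (rule poly_P_nonzero)
  show "C (Fin z) = (if poly Q z = 0 then Infty else Fin (poly P z / poly Q z))" for z
    unfolding C_eq by (rule rational_map_to_fract(1)) (rule degrees(3), erule poly_P_nonzero)
  show "C Infty = Infty"
    unfolding C_eq
    by (rule rational_map_to_fract(2)) (rule degrees(3), erule poly_P_nonzero, rule degrees(1))
qed (use degrees in auto)

definition f :: "complex \<Rightarrow> complex" where
  "f z = z - poly p z / poly (pderiv p) z
    - (poly p z)\<^sup>2 * poly (pderiv (pderiv p)) z / (2 * poly (pderiv p) z ^ 3)"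

lemma f_eq: "poly Q z \<noteq> 0 \<Longrightarrow> poly P z / poly Q z = f z"
proof -
  assume "poly Q z \<noteq> 0"
  then have "poly (pderiv p) z \<noteq> 0"
    by (simp add: Q_def)
  then show ?thesis
    unfolding P_def Q_def f_def by (simp add: field_simps power2_eq_square power3_eq_cube)
qed

end

section \<open>The immediate basins and the Julia set\<close>

lemma connected_component_set_Fin:
  assumes "Infty \<notin> U"
  shows "connected_component_set U (Fin z) = Fin ` connected_component_set (Fin -` U) z"
proof (cases "Fin z \<in> U")
  case True
  let ?A = "connected_component_set U (Fin z)" and ?S = "connected_component_set (Fin -` U) z"
  have "Fin ` ?S \<subseteq> ?A"
    using True connected_component_subset[of "Fin -` U" z]
    by (intro connected_component_maximal connected_continuous_image continuous_on_Fin) auto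
  have sub: "finite_part ` ?A \<subseteq> ?S"
  proof (rule connected_component_maximal)
    show "z \<in> finite_part ` ?A"
      using True by (intro image_eqI[of _ _ "Fin z"]) auto
    have "Infty \<notin> ?A"
      using assms connected_component_subset by blast
    then show "connected (finite_part ` ?A)"
      by (intro connected_continuous_image continuous_on_finite_part) auto
    show "finite_part ` ?A \<subseteq> Fin -` U"
      using assms connected_component_subset[of U "Fin z"] by (auto simp: subset_iff) (metis Fin_finite_part)
  qed
  have "?A \<subseteq> Fin ` ?S"
  proof (intro subsetI)
    fix x assume x: "x \<in> ?A"
    then have "x \<noteq> Infty"
      using assms connected_component_subset[of U "Fin z"] by blast
    then show "x \<in> Fin ` ?S"
      using x sub by (intro image_eqI[of _ _ "finite_part x"]) auto
  qed
  with \<open>Fin ` ?S \<subseteq> ?A\<close> show ?thesis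
    by blast
next
  case False
  then have "connected_component_set U (Fin z) = {}" "connected_component_set (Fin -` U) z = {}"
    unfolding connected_component_eq_empty by simp_all
  then show ?thesis
    by (simp only: image_empty)
qed

lemma closure_Fin_image:
  assumes "Fin z \<in> closure (Fin ` S)"
  shows "z \<in> closure S"
proof (rule ccontr)
  assume "z \<notin> closure S"
  then have "Fin z \<in> Fin ` (- closure S)" "open (Fin ` (- closure S))"
    by (auto intro: open_Fin_image)
  then obtain w where "w \<in> S" "Fin w \<in> Fin ` (- closure S)"
    using assms open_Int_closure_eq_empty[of "Fin ` (- closure S)" "Fin ` S"] by blast
  then show False
    using closure_subset by auto
qed

context quartic_chebyshev
begin

sublocale ax: imaginary_axis b "1 - b"
  by standard (use b in auto)

text \<open>The pole 0 is excluded: division by zero makes \<open>ax.g 0 = 0\<close>, whereas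
  \<open>C\<close> sends 0 to \<open>Infty\<close>.\<close>

lemma C_imaginary:
  assumes "y \<noteq> 0"
  shows "C (Fin (\<i> * of_real y)) = Fin (\<i> * of_real (ax.g y))"
proof -
  let ?z = "\<i> * complex_of_real y"
  have vals: "poly p ?z = of_real (ax.q y)" "poly (pderiv p) ?z = - \<i> * of_real (ax.q1 y)"
    "poly (pderiv (pderiv p)) ?z = - of_real (ax.q2 y)"
    unfolding poly_p poly_p1 poly_p2 ax.q_factor ax.q1_factor ax.q2_def
    by (simp_all add: power_mult_distrib algebra_simps)
  have q1: "complex_of_real (ax.q1 y) \<noteq> 0"
    using ax.q1_nonzero[OF assms] by simp
  then have Q: "poly Q ?z \<noteq> 0"
    using vals(2) by (simp add: Q_def)
  have "f ?z = \<i> * of_real (ax.g y)"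
    using q1 unfolding f_def vals ax.g_def
    by (simp add: field_simps power2_eq_square power3_eq_cube)
  with Q f_eq[OF Q] show ?thesis
    by (simp add: C_Fin)
qed

lemma funpow_C_imaginary:
  assumes "\<And>k. k < n \<Longrightarrow> (ax.g ^^ k) y \<noteq> 0"
  shows "(C ^^ n) (Fin (\<i> * of_real y)) = Fin (\<i> * of_real ((ax.g ^^ n) y))"
  using assms by (induction n) (auto simp: C_imaginary)

text \<open>The sign \<open>\<sigma>\<close> lets every statement treat the upper and the lower root
  together.\<close>

definition root :: "real \<Rightarrow> complex" where "root \<sigma> = \<i> * of_real (\<sigma> * sqrt b)"

lemma root_attracting:
  assumes "\<sigma> = 1 \<or> \<sigma> = - 1"
  shows "\<exists>B. attracting_point C (Fin (root \<sigma>)) B"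
proof -
  have "(root \<sigma>)\<^sup>2 = - of_real ((\<sigma> * sqrt b)\<^sup>2)"
    by (simp add: root_def power_mult_distrib)
  also have "(\<sigma> * sqrt b)\<^sup>2 = b"
    using assms b by auto
  finally have sq: "(root \<sigma>)\<^sup>2 = of_real (- b)"
    by simp
  have p0: "poly p (root \<sigma>) = 0"
    by (simp add: poly_p sq)
  have Q: "poly Q (root \<sigma>) \<noteq> 0"
  proof -
    have "root \<sigma> \<noteq> 0"
      using assms b by (auto simp: root_def)
    moreover have "(root \<sigma>)\<^sup>2 \<noteq> of_real ((1 - b) / 2)"
      unfolding sq of_real_eq_iff using b by simp
    ultimately show ?thesis
      by (simp add: poly_Q_eq_0_iff)
  qed
  then have p1: "poly (pderiv p) (root \<sigma>) \<noteq> 0"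
    by (simp add: Q_def)
  have "(f has_field_derivative 0) (at (root \<sigma>))"
    using chebyshev_step_has_derivative[OF poly_DERIV[of p] poly_DERIV poly_DERIV p1]
    by (simp add: f_def[abs_def] p0)
  moreover have "open {z. poly Q z \<noteq> 0}"
    by (intro open_Collect_neq continuous_intros)
  ultimately have "((\<lambda>z. poly P z / poly Q z) has_field_derivative 0) (at (root \<sigma>))"
    by (rule has_field_derivative_transform_within_open) (use Q f_eq in auto)
  moreover have "poly P (root \<sigma>) / poly Q (root \<sigma>) = root \<sigma>"
    using f_eq[OF Q] by (simp add: f_def p0)
  ultimately show ?thesis
    using superattracting_point Q by blast
qed

lemma imaginary_in_basin:
  assumes "\<sigma> = 1 \<or> \<sigma> = - 1" "y > 0" "ax.G y > 0"
  shows "Fin (\<i> * of_real (\<sigma> * y)) \<in> basin C (Fin (root \<sigma>))"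
proof -
  have iter: "(ax.g ^^ n) (\<sigma> * y) = \<sigma> * (ax.g ^^ n) y" for n
    using assms(1) ax.g_funpow_minus by auto
  have "(ax.g ^^ n) (\<sigma> * y) \<noteq> 0" for n
    using ax.funpow_g_tendsto(2)[OF assms(2,3), of n] assms(1) by (auto simp: iter)
  then have "(C ^^ n) (Fin (\<i> * of_real (\<sigma> * y))) = Fin (\<i> * of_real (\<sigma> * (ax.g ^^ n) y))" for n
    using funpow_C_imaginary[of n "\<sigma> * y"] by (simp only: iter) blast
  moreover have "(\<lambda>n. \<i> * complex_of_real (\<sigma> * (ax.g ^^ n) y)) \<longlonglongrightarrow> root \<sigma>"
    unfolding root_def by (intro tendsto_intros ax.funpow_g_tendsto assms)
  ultimately show ?thesis
    by (simp add: basin_def tendsto_Fin_iff)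
qed

lemma G_pos:
  assumes "y \<ge> sqrt b"
  shows "y > 0 \<and> ax.G y > 0"
proof -
  have "sqrt b > 0"
    using b by simp
  then show ?thesis
    using assms ax.G_nonpos_bound[of y] by linarith
qed

lemma root_in_basin: "\<sigma> = 1 \<or> \<sigma> = - 1 \<Longrightarrow> Fin (root \<sigma>) \<in> basin C (Fin (root \<sigma>))"
  using imaginary_in_basin[of \<sigma> "sqrt b"] G_pos[of "sqrt b"] by (simp add: root_def)

lemma real_not_in_basin:
  assumes "\<sigma> = 1 \<or> \<sigma> = - 1" "x \<in> insert Infty (Fin ` \<real>)"
  shows "x \<notin> basin C (Fin (root \<sigma>))"
proof
  assume "x \<in> basin C (Fin (root \<sigma>))"
  have C_real: "C x \<in> insert Infty (Fin ` \<real>)" if "x \<in> insert Infty (Fin ` \<real>)" for x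
  proof (cases x)
    case (Fin z)
    then have z: "z \<in> \<real>"
      using that by auto
    have "f z \<in> \<real>"
      unfolding f_def poly_p poly_p1 poly_p2
      by (intro Reals_diff Reals_divide Reals_mult Reals_power Reals_add Reals_of_real z) auto
    then show ?thesis
      using f_eq[of z] by (simp add: Fin C_Fin)
  qed (simp add: C_Infty)
  have "(C ^^ n) x \<in> insert Infty (Fin ` \<real>)" for n
    using assms(2) C_real by (induction n) auto
  moreover have "open (Fin ` {z. Im z \<noteq> 0})"
    by (intro open_Fin_image open_Collect_neq continuous_intros)
  moreover have "Fin (root \<sigma>) \<in> Fin ` {z. Im z \<noteq> 0}"
    using assms(1) b by (auto simp: root_def)
  ultimately have "\<forall>\<^sub>F n in sequentially. (C ^^ n) x \<in> Fin ` {z. Im z \<noteq> 0}"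
    using \<open>x \<in> basin C (Fin (root \<sigma>))\<close> by (auto simp: basin_def dest: topological_tendstoD)
  then obtain n where "(C ^^ n) x \<in> Fin ` {z. Im z \<noteq> 0}"
    using eventually_happens' sequentially_bot by blast
  with \<open>(C ^^ n) x \<in> insert Infty (Fin ` \<real>)\<close> show False
    by (auto simp: complex_is_Real_iff)
qed

text \<open>The points \<i> (sqrt b + n + 1) of the axis lie in the basin and escape to
  \<open>Infty\<close>; \<open>w n\<close> is their coordinate in the inverted chart.\<close>

lemma Infty_in_closure_basin: "Infty \<in> closure (basin C (Fin (root 1)))"
proof -
  define w where "w n = inverse (\<i> * complex_of_real (sqrt b + real (Suc n)))" for n
  have pos: "sqrt b + real (Suc n) > 0" for n
    using b by (simp add: add_nonneg_pos)
  have nz: "\<i> * complex_of_real (sqrt b + real (Suc n)) \<noteq> 0" for n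
    using pos[of n] by (metis complex_i_not_zero less_irrefl mult_eq_0_iff of_real_eq_0_iff)
  have "sphere_inverse (Fin (w n)) \<in> basin C (Fin (root 1))" for n
  proof -
    have "sphere_inverse (Fin (w n)) = Fin (\<i> * of_real (1 * (sqrt b + real (Suc n))))"
      using nz[of n] by (simp add: w_def)
    then show ?thesis
      using imaginary_in_basin[of 1 "sqrt b + real (Suc n)"] G_pos[of "sqrt b + real (Suc n)"] by simp
  qed
  moreover have "w \<longlonglongrightarrow> 0"
  proof (rule Lim_null_comparison)
    show "\<forall>\<^sub>F n in sequentially. cmod (w n) \<le> inverse (real (Suc n))"
    proof (rule always_eventually, rule allI)
      fix n
      have "cmod (w n) = inverse (sqrt b + real (Suc n))"
        unfolding w_def norm_inverse norm_mult norm_of_real using pos[of n] by simp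
      then show "cmod (w n) \<le> inverse (real (Suc n))"
        using b by (simp add: le_imp_inverse_le del: of_nat_Suc)
    qed
  qed (rule LIMSEQ_inverse_real_of_nat)
  then have "(\<lambda>n. sphere_inverse (Fin (w n))) \<longlonglongrightarrow> sphere_inverse (Fin 0)"
    using continuous_on_sphere_inverse[of UNIV]
    by (intro isCont_tendsto_compose[of _ sphere_inverse]) (simp_all only: tendsto_Fin_iff
        continuous_on_eq_continuous_at open_UNIV UNIV_I Ball_def simp_thms)
  ultimately show ?thesis
    unfolding closure_sequential by (intro exI[of _ "\<lambda>n. sphere_inverse (Fin (w n))"]) simp
qed

text \<open>A Fatou point in the closure of a basin belongs to the basin, but \<open>Infty\<close>
  is fixed. No multiplier at infinity has to be computed.\<close>

lemma Infty_not_fatou: "Infty \<notin> fatou_set C"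
  using attracting_point.fatou_closure_basin[OF _ compact_riemann_sphere _ Infty_in_closure_basin]
    root_attracting[of 1] real_not_in_basin[of 1 Infty] by blast

lemma connected_fatou_in_basin:
  assumes "\<sigma> = 1 \<or> \<sigma> = - 1" "connected S" "S \<subseteq> fatou_set C" "S \<inter> basin C (Fin (root \<sigma>)) \<noteq> {}"
  shows "S \<subseteq> basin C (Fin (root \<sigma>))"
  using root_attracting[OF assms(1)] attracting_point.connected_fatou_subset_basin
    compact_riemann_sphere assms(2-4) by blast

lemma basin_in_fatou: "\<sigma> = 1 \<or> \<sigma> = - 1 \<Longrightarrow> basin C (Fin (root \<sigma>)) \<subseteq> fatou_set C"
  using root_attracting attracting_point.basin_subset_fatou_set by blast

lemma basin_not_surrounding_real:
  assumes "\<sigma> = 1 \<or> \<sigma> = - 1" "Fin ` T \<subseteq> basin C (Fin (root \<sigma>))" "x \<in> \<real>"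
  shows "x \<notin> inside T"
proof (rule not_inside_unbounded_connected[of \<real>])
  show "connected (\<real> :: complex set)"
    unfolding Reals_def by (intro connected_continuous_image continuous_intros connected_UNIV)
  show "\<not> bounded (\<real> :: complex set)"
  proof
    assume "bounded (\<real> :: complex set)"
    then obtain B where B: "\<And>x. x \<in> \<real> \<Longrightarrow> cmod x \<le> B"
      by (auto simp: bounded_iff)
    from B[of "of_real (\<bar>B\<bar> + 1)"] show False
      by (simp add: norm_of_real del: of_real_add)
  qed
  show "\<real> \<inter> T = {}"
    using real_not_in_basin[OF assms(1)] assms(2) by blast
qed (rule assms)

lemma pole_real: "poly Q z = 0 \<Longrightarrow> z \<in> \<real>"
proof -
  assume "poly Q z = 0"
  then consider "z = 0" | "z\<^sup>2 = (of_real (sqrt ((1 - b) / 2)))\<^sup>2"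
    using b by (auto simp: poly_Q_eq_0_iff simp flip: of_real_power)
  then show ?thesis
    by cases (auto simp: power2_eq_iff)
qed

lemma two_poles: obtains \<alpha> \<beta> where "poly Q \<alpha> = 0" "poly Q \<beta> = 0" "\<alpha> \<noteq> \<beta>"
proof -
  have "(complex_of_real (sqrt ((1 - b) / 2)))\<^sup>2 = of_real ((1 - b) / 2)"
    using b by (simp flip: of_real_power)
  moreover have "complex_of_real (sqrt ((1 - b) / 2)) \<noteq> 0"
    using b by simp
  ultimately show thesis
    using that[of 0 "of_real (sqrt ((1 - b) / 2))"] by (auto simp: poly_Q_eq_0_iff)
qed

section \<open>The immediate basins as subsets of the plane\<close>

definition basin_component :: "real \<Rightarrow> complex set" where
  "basin_component \<sigma> = connected_component_set (Fin -` fatou_set C) (root \<sigma>)"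

lemma immediate_basin_eq: "immediate_basin C (Fin (root \<sigma>)) = Fin ` basin_component \<sigma>"
  unfolding immediate_basin_def basin_component_def
  by (rule connected_component_set_Fin[OF Infty_not_fatou])

lemma basin_component_subset:
  assumes "\<sigma> = 1 \<or> \<sigma> = - 1"
  shows "Fin ` basin_component \<sigma> \<subseteq> basin C (Fin (root \<sigma>))"
proof (rule connected_fatou_in_basin[OF assms])
  show "connected (Fin ` basin_component \<sigma>)"
    by (auto simp: basin_component_def intro!: connected_continuous_image continuous_on_Fin)
  show "Fin ` basin_component \<sigma> \<subseteq> fatou_set C"
    using connected_component_subset by (fastforce simp: basin_component_def)
  have "Fin (root \<sigma>) \<in> fatou_set C"
    using root_in_basin[OF assms] basin_in_fatou[OF assms] by blast
  then have "root \<sigma> \<in> basin_component \<sigma>"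
    by (simp add: basin_component_def)
  then show "Fin ` basin_component \<sigma> \<inter> basin C (Fin (root \<sigma>)) \<noteq> {}"
    using root_in_basin[OF assms] by blast
qed

lemma funpow_basin_image:
  "S \<subseteq> basin C \<zeta> \<Longrightarrow> (C ^^ m) ` S \<subseteq> basin C \<zeta>"
  using funpow_in_basin_iff[of m C] by blast

lemma inside_basin_fatou:
  assumes \<sigma>: "\<sigma> = 1 \<or> \<sigma> = - 1" and T: "compact T" "connected T" "Fin ` T \<subseteq> basin C (Fin (root \<sigma>))"
  shows "Fin ` inside T \<subseteq> fatou_set C"
proof safe
  fix a assume "a \<in> inside T"
  show "Fin a \<in> fatou_set C"
  proof (rule ccontr)
    assume a: "Fin a \<notin> fatou_set C"
    obtain \<alpha> \<beta> where \<alpha>\<beta>: "poly Q \<alpha> = 0" "poly Q \<beta> = 0" "\<alpha> \<noteq> \<beta>"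
      by (rule two_poles)
    have "Fin ` T \<subseteq> fatou_set C"
      using T(3) basin_in_fatou[OF \<sigma>] by blast
    then obtain m T' r where T': "Fin ` T' = (C ^^ m) ` Fin ` T" "poly Q r = 0" "r \<in> inside T'"
      using iterate_surrounds_pole[OF Infty_not_fatou \<alpha>\<beta> T(1,2) _ \<open>a \<in> inside T\<close> a] by metis
    then have "Fin ` T' \<subseteq> basin C (Fin (root \<sigma>))"
      using funpow_basin_image[OF T(3)] by simp
    then show False
      using basin_not_surrounding_real[OF \<sigma>] pole_real T' by blast
  qed
qed

text \<open>For an open connected plane set it is enough that loops do not wind around points off
  the set. A point inside a loop cannot be off it: by \<open>inside_basin_fatou\<close> the loop and
  its inside form a connected subset of the Fatou set, which lies in the component of the
  loop.\<close>

lemma simply_connected_immediate_basin: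
  assumes \<sigma>: "\<sigma> = 1 \<or> \<sigma> = - 1"
  shows "simply_connected (immediate_basin C (Fin (root \<sigma>)))"
proof -
  let ?S = "basin_component \<sigma>"
  have "open (Fin -` fatou_set C)"
    by (intro open_vimage open_fatou_set continuous_on_Fin)
  then have "open ?S"
    unfolding basin_component_def by (rule open_connected_component)
  have "winding_number \<gamma> z = 0"
    if \<gamma>: "path \<gamma>" "path_image \<gamma> \<subseteq> ?S" "pathfinish \<gamma> = pathstart \<gamma>" "z \<notin> ?S" for \<gamma> z
  proof (rule winding_number_zero_in_outside[OF \<gamma>(1,3)], rule ccontr)
    let ?T = "path_image \<gamma>"
    assume "z \<notin> outside ?T"
    then have z: "z \<in> inside ?T"
      using \<gamma>(2,4) inside_Un_outside[of ?T] by blast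
    have T: "compact ?T" "connected ?T"
      using \<gamma>(1) by (auto intro: compact_path_image connected_path_image)
    have "Fin ` ?T \<subseteq> basin C (Fin (root \<sigma>))"
      using \<gamma>(2) basin_component_subset[OF \<sigma>] by blast
    then have "Fin ` inside ?T \<subseteq> fatou_set C"
      by (rule inside_basin_fatou[OF \<sigma> T])
    moreover have TS: "?T \<subseteq> Fin -` fatou_set C"
      using \<gamma>(2) connected_component_subset unfolding basin_component_def by blast
    ultimately have sub: "?T \<union> inside ?T \<subseteq> Fin -` fatou_set C"
      by blast
    have "connected (?T \<union> inside ?T)"
      by (intro connected_with_inside T compact_imp_closed)
    moreover obtain t where t: "t \<in> ?T"
      using path_image_nonempty by blast
    ultimately have "?T \<union> inside ?T \<subseteq> connected_component_set (Fin -` fatou_set C) t"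
      using sub by (intro connected_component_maximal) auto
    also have "connected_component_set (Fin -` fatou_set C) t = ?S"
      using t \<gamma>(2) connected_component_eq unfolding basin_component_def by blast
    finally show False
      using z \<gamma>(4) by blast
  qed
  moreover have "connected ?S"
    by (simp add: basin_component_def)
  ultimately have "simply_connected ?S"
    using simply_connected_eq_winding_number_zero[OF \<open>open ?S\<close>] by blast
  moreover have "?S homeomorphic Fin ` ?S"
    using homeomorphism_Fin homeomorphic_def by blast
  ultimately show ?thesis
    unfolding immediate_basin_eq by (metis homeomorphic_simply_connected)
qed

text \<open>This ray of the axis is why the immediate basins are unbounded.\<close>

lemma imaginary_in_component:
  assumes \<sigma>: "\<sigma> = 1 \<or> \<sigma> = - 1" and y: "y \<ge> sqrt b"
  shows "\<i> * of_real (\<sigma> * y) \<in> basin_component \<sigma>"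
proof -
  define K where "K = (\<lambda>y. \<i> * complex_of_real (\<sigma> * y)) ` {sqrt b..}"
  have "K \<subseteq> basin_component \<sigma>"
    unfolding basin_component_def
  proof (rule connected_component_maximal)
    show "root \<sigma> \<in> K"
      by (auto simp: K_def root_def)
    show "connected K"
      unfolding K_def by (intro connected_continuous_image continuous_intros convex_connected) simp
    show "K \<subseteq> Fin -` fatou_set C"
      using imaginary_in_basin[OF \<sigma>] G_pos basin_in_fatou[OF \<sigma>] by (auto simp: K_def)
  qed
  then show ?thesis
    using y by (auto simp: K_def)
qed

lemma not_bounded_component:
  assumes \<sigma>: "\<sigma> = 1 \<or> \<sigma> = - 1"
  shows "\<not> bounded (basin_component \<sigma>)"
proof
  assume "bounded (basin_component \<sigma>)"
  then obtain B where B: "\<And>z. z \<in> basin_component \<sigma> \<Longrightarrow> cmod z \<le> B"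
    by (auto simp: bounded_iff)
  have "cmod (\<i> * of_real (\<sigma> * (sqrt b + \<bar>B\<bar> + 1))) \<le> B"
    by (rule B[OF imaginary_in_component[OF \<sigma>]]) simp
  moreover have "cmod (\<i> * of_real (\<sigma> * (sqrt b + \<bar>B\<bar> + 1))) = \<bar>\<sigma> * (sqrt b + \<bar>B\<bar> + 1)\<bar>"
    by (simp only: norm_mult norm_of_real norm_ii mult_1)
  moreover have "\<bar>\<sigma> * (sqrt b + \<bar>B\<bar> + 1)\<bar> = sqrt b + \<bar>B\<bar> + 1"
    using \<sigma> b by (auto simp: abs_mult)
  moreover have "sqrt b \<ge> 0"
    using b by simp
  ultimately show False
    by linarith
qed

section \<open>Symmetry and the obstruction to surrounding a pole\<close>

definition neg :: "riemann_sphere \<Rightarrow> riemann_sphere" where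
  "neg x = (case x of Fin z \<Rightarrow> Fin (- z) | Infty \<Rightarrow> Infty)"

lemma neg_simps [simp]: "neg (Fin z) = Fin (- z)" "neg Infty = Infty"
  by (simp_all add: neg_def)

lemma C_neg: "C (neg x) = neg (C x)"
proof (cases x)
  case (Fin z)
  have "f (- z) = - f z"
    by (simp add: f_def poly_p poly_p1 poly_p2)
  moreover have "poly Q (- z) = 0 \<longleftrightarrow> poly Q z = 0"
    by (simp add: poly_Q_eq_0_iff)
  ultimately show ?thesis
    using f_eq[of z] f_eq[of "- z"] by (auto simp: Fin C_Fin)
qed (simp add: C_Infty)

lemma neg_basin: "x \<in> basin C (Fin (root \<sigma>)) \<Longrightarrow> neg x \<in> basin C (Fin (root (- \<sigma>)))"
proof -
  assume x: "x \<in> basin C (Fin (root \<sigma>))"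
  interpret neg: rational_sphere_map "[:0, - 1:]" 1 neg
    by standard simp_all
  have iter: "(C ^^ n) (neg x) = neg ((C ^^ n) x)" for n
    by (induction n) (simp_all add: C_neg)
  have "isCont neg (Fin (root \<sigma>))"
    using neg.continuous_C by (simp add: continuous_on_eq_continuous_at)
  then have "(\<lambda>n. neg ((C ^^ n) x)) \<longlonglongrightarrow> neg (Fin (root \<sigma>))"
    by (rule isCont_tendsto_compose) (use x in \<open>simp add: basin_def\<close>)
  then show ?thesis
    by (simp add: basin_def iter root_def)
qed

text \<open>A whole segment of the axis around the given point lies in the Fatou set. By expansion
  some point \<open>t\<close> of it reaches 0 or the region where \<open>G\<close> is positive. The
  former would lead on to \<open>Infty\<close>, so \<open>t\<close> lies in a basin, and the segment
  links it to \<open>T\<close>.\<close>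

lemma imaginary_fatou_basin:
  assumes T: "connected T" "Fin ` T \<subseteq> fatou_set C" "\<i> * of_real y \<in> T"
  obtains \<sigma> where "\<sigma> = 1 \<or> \<sigma> = - 1" "Fin ` T \<subseteq> basin C (Fin (root \<sigma>))"
proof -
  let ?K = "\<lambda>v. (\<lambda>t. \<i> * complex_of_real t) ` {y..v}"
  have "open ((\<lambda>t. Fin (\<i> * complex_of_real t)) -` fatou_set C)"
    by (intro open_vimage open_fatou_set continuous_on_compose2[OF continuous_on_Fin[of UNIV]]
        continuous_intros) auto
  moreover have "y \<in> (\<lambda>t. Fin (\<i> * complex_of_real t)) -` fatou_set C"
    using T by auto
  ultimately obtain e where e: "e > 0" "cball y e \<subseteq> (\<lambda>t. Fin (\<i> * complex_of_real t)) -` fatou_set C"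
    using open_contains_cball by blast
  then have K: "Fin ` ?K (y + e) \<subseteq> fatou_set C"
    by (auto simp: cball_def dist_real_def subset_iff)
  obtain t n where t: "t \<in> {y..y + e}" "(ax.g ^^ n) t = 0 \<or> ax.G ((ax.g ^^ n) t) > 0"
    using ax.expanding_interval[of y "y + e"] e(1) by (meson less_add_same_cancel1)
  have tF: "Fin (\<i> * of_real t) \<in> fatou_set C"
    using K t(1) by auto
  \<comment> \<open>Strong induction, because \<open>C\<close> follows \<open>ax.g\<close> up to
    time k only if 0 has not been hit earlier.\<close>
  have nz: "(ax.g ^^ k) t \<noteq> 0" for k
  proof (induction k rule: less_induct)
    case (less k)
    then have *: "(C ^^ k) (Fin (\<i> * of_real t)) = Fin (\<i> * of_real ((ax.g ^^ k) t))"
      by (rule funpow_C_imaginary)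
    show ?case
    proof
      assume "(ax.g ^^ k) t = 0"
      then have "(C ^^ Suc k) (Fin (\<i> * of_real t)) = Infty"
        using * by (simp add: C_Fin poly_Q_eq_0_iff)
      then show False
        using fatou_forward[OF Infty_not_fatou tF, of "Suc k"] Infty_not_fatou by simp
    qed
  qed
  define w where "w = (ax.g ^^ n) t"
  \<comment> \<open>The half of the axis containing \<open>w\<close> decides which root attracts
    it.\<close>
  define \<sigma> where "\<sigma> = sgn w"
  have w: "w \<noteq> 0" "ax.G w > 0"
    using nz[of n] t(2) by (auto simp: w_def)
  have \<sigma>: "\<sigma> = 1 \<or> \<sigma> = - 1"
    using w(1) by (auto simp: \<sigma>_def sgn_if)
  have "ax.G \<bar>w\<bar> > 0"
    using w by (auto simp: ax.G_def ax.q_def ax.q2_def ax.q1_minus abs_if)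
  then have "Fin (\<i> * of_real (\<sigma> * \<bar>w\<bar>)) \<in> basin C (Fin (root \<sigma>))"
    using w(1) by (intro imaginary_in_basin[OF \<sigma>]) auto
  then have "(C ^^ n) (Fin (\<i> * of_real t)) \<in> basin C (Fin (root \<sigma>))"
    using funpow_C_imaginary[of n t] nz by (simp add: \<sigma>_def w_def sgn_mult_abs)
  then have "Fin (\<i> * of_real t) \<in> basin C (Fin (root \<sigma>))"
    by (simp only: funpow_in_basin_iff)
  moreover have "Fin (\<i> * of_real t) \<in> Fin ` (T \<union> ?K (y + e))"
    using t(1) by auto
  ultimately have meets: "Fin ` (T \<union> ?K (y + e)) \<inter> basin C (Fin (root \<sigma>)) \<noteq> {}"
    by blast
  have "connected (?K (y + e))"
    by (intro connected_continuous_image continuous_intros) auto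
  moreover have "\<i> * complex_of_real y \<in> ?K (y + e)"
    using e(1) by auto
  ultimately have "connected (T \<union> ?K (y + e))"
    using T(1,3) by (intro connected_Un) blast+
  then have "connected (Fin ` (T \<union> ?K (y + e)))"
    by (intro connected_continuous_image continuous_on_Fin)
  moreover have "Fin ` (T \<union> ?K (y + e)) \<subseteq> fatou_set C"
    unfolding image_Un using T(2) K by (rule Un_least)
  ultimately have "Fin ` (T \<union> ?K (y + e)) \<subseteq> basin C (Fin (root \<sigma>))"
    using meets by (rule connected_fatou_in_basin[OF \<sigma>])
  then show thesis
    using that[OF \<sigma>] by blast
qed

lemma not_surrounding_0:
  assumes T: "connected T" "Fin ` T \<subseteq> fatou_set C"
  shows "0 \<notin> inside T"
proof
  assume 0: "0 \<in> inside T"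
  let ?K = "range (\<lambda>t. \<i> * complex_of_real t)"
  have "?K \<inter> T \<noteq> {}"
  proof
    assume "?K \<inter> T = {}"
    moreover have "connected ?K"
      by (intro connected_continuous_image continuous_intros connected_UNIV)
    moreover have "\<not> bounded ?K"
    proof
      assume "bounded ?K"
      then obtain B where B: "\<And>t. cmod (\<i> * of_real t) \<le> B"
        by (auto simp: bounded_iff)
      from B[of "\<bar>B\<bar> + 1"] show False
        by (simp only: norm_mult norm_of_real norm_ii mult_1)
    qed
    moreover have "0 \<in> ?K"
      by (auto intro: image_eqI[of _ _ 0])
    ultimately show False
      using not_inside_unbounded_connected 0 by blast
  qed
  then obtain y where "\<i> * of_real y \<in> T"
    by blast
  then obtain \<sigma> where "\<sigma> = 1 \<or> \<sigma> = - 1" "Fin ` T \<subseteq> basin C (Fin (root \<sigma>))"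
    using imaginary_fatou_basin[OF T] by blast
  then show False
    using basin_not_surrounding_real[of \<sigma> T 0] 0 by simp
qed

lemma not_surrounding_accessible_pole:
  assumes T: "connected T" "Fin ` T \<subseteq> fatou_set C" and \<sigma>: "\<sigma> = 1 \<or> \<sigma> = - 1"
    and z: "poly Q z = 0" "Fin z \<in> closure (immediate_basin C (Fin (root \<sigma>)))"
    and r: "poly Q r = 0" "r = z \<or> r = - z"
  shows "r \<notin> inside T"
proof
  assume inside: "r \<in> inside T"
  \<comment> \<open>Multiplication by \<open>\<epsilon>\<close> carries the accessible pole
    \<open>z\<close> to the surrounded pole \<open>r\<close>.\<close>
  define \<epsilon> :: real where "\<epsilon> = (if r = z then 1 else - 1)"
  have \<epsilon>: "\<epsilon> = 1 \<or> \<epsilon> = - 1" "r = of_real \<epsilon> * z"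
    using r(2) by (auto simp: \<epsilon>_def)
  \<comment> \<open>A connected set stays connected when a point of its closure is added, so
    \<open>z\<close> is joined to infinity through the basin.\<close>
  define S where "S = insert z (basin_component \<sigma>)"
  have "z \<in> closure (basin_component \<sigma>)"
    using z(2) by (intro closure_Fin_image) (simp add: immediate_basin_eq)
  then have "S \<subseteq> closure (basin_component \<sigma>)"
    using closure_subset[of "basin_component \<sigma>"] by (simp add: S_def)
  moreover have "connected (basin_component \<sigma>)"
    by (simp add: basin_component_def)
  ultimately have "connected S"
    using connected_intermediate_closure[of "basin_component \<sigma>" S] by (simp add: S_def subset_insertI)
  then have "connected ((*) (of_real \<epsilon>) ` S)"
    by (intro connected_continuous_image continuous_intros)
  moreover have "\<not> bounded ((*) (complex_of_real \<epsilon>) ` S)"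
  proof
    assume "bounded ((*) (complex_of_real \<epsilon>) ` S)"
    then have "bounded S"
      using \<epsilon>(1) unfolding bounded_iff by (auto simp: norm_mult) blast+
    then show False
      using not_bounded_component[OF \<sigma>] bounded_subset by (auto simp: S_def)
  qed
  moreover have "r \<in> (*) (of_real \<epsilon>) ` S"
    using \<epsilon>(2) by (auto simp: S_def)
  ultimately have "(*) (of_real \<epsilon>) ` S \<inter> T \<noteq> {}"
    using not_inside_unbounded_connected inside by blast
  moreover have "r \<notin> T"
    using inside inside_no_overlap by blast
  ultimately obtain w where w: "w \<in> basin_component \<sigma>" "of_real \<epsilon> * w \<in> T"
    using \<epsilon>(2) by (auto simp: S_def)
  \<comment> \<open>The sign of the basin into which multiplication by \<open>\<epsilon>\<close>
    carries the basin of \<open>root \<sigma>\<close>.\<close>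
  define \<tau> where "\<tau> = \<epsilon> * \<sigma>"
  have \<tau>: "\<tau> = 1 \<or> \<tau> = - 1"
    using \<epsilon>(1) \<sigma> by (auto simp: \<tau>_def)
  have "Fin w \<in> basin C (Fin (root \<sigma>))"
    using w(1) basin_component_subset[OF \<sigma>] by blast
  then have "Fin (of_real \<epsilon> * w) \<in> basin C (Fin (root \<tau>))"
    using \<epsilon>(1) neg_basin[of "Fin w" \<sigma>] by (auto simp: \<tau>_def)
  then have "Fin ` T \<subseteq> basin C (Fin (root \<tau>))"
    using w(2) T
    by (intro connected_fatou_in_basin[OF \<tau>] connected_continuous_image continuous_on_Fin) auto
  then show False
    using basin_not_surrounding_real[OF \<tau>] pole_real[OF r(1)] inside by blast
qed

lemma connected_julia_set:
  assumes \<sigma>: "\<sigma> = 1 \<or> \<sigma> = - 1" and z: "poly Q z = 0" "z \<noteq> 0"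
    and fr: "Fin z \<in> closure (immediate_basin C (Fin (root \<sigma>)))"
  shows "connected (julia_set C)"
proof (rule ccontr)
  assume "\<not> connected (julia_set C)"
  moreover have "closed (julia_set C)" "Infty \<in> julia_set C"
    using open_fatou_set Infty_not_fatou by (auto simp: julia_set_def)
  ultimately obtain T a where T: "compact T" "connected T" "Fin ` T \<subseteq> fatou_set C"
    and a: "a \<in> inside T" "Fin a \<notin> fatou_set C"
    using closed_disconnected_surrounded[of "julia_set C"] by (auto simp: julia_set_def)
  obtain \<alpha> \<beta> where \<alpha>\<beta>: "poly Q \<alpha> = 0" "poly Q \<beta> = 0" "\<alpha> \<noteq> \<beta>"
    by (rule two_poles)
  obtain T' r where T': "connected T'" "Fin ` T' \<subseteq> fatou_set C" and r: "poly Q r = 0" "r \<in> inside T'"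
    using iterate_surrounds_pole[OF Infty_not_fatou \<alpha>\<beta> T a] by metis
  have "r \<noteq> 0"
    using not_surrounding_0[OF T'] r(2) by blast
  \<comment> \<open>The nonzero poles are \<open>z\<close> and \<open>- z\<close>, so accessibility
    of \<open>z\<close> settles both.\<close>
  then have "r\<^sup>2 = of_real ((1 - b) / 2)" "z\<^sup>2 = of_real ((1 - b) / 2)"
    using r(1) z poly_Q_eq_0_iff by blast+
  then have "r = z \<or> r = - z"
    by (metis power2_eq_iff)
  then show False
    using not_surrounding_accessible_pole[OF T' \<sigma> z(1) fr r(1)] r(2) by blast
qed

end

theorem theorem3p13:
  fixes b :: real
  assumes "0 < b" and "b < 1"
  defines "C \<equiv> chebyshev (quartic b)"
  defines "A\<^sub>1 \<equiv> immediate_basin C (Fin (\<i> * of_real (sqrt b)))"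
  defines "A\<^sub>2 \<equiv> immediate_basin C (Fin (- \<i> * of_real (sqrt b)))"
  shows "simply_connected A\<^sub>1 \<and> simply_connected A\<^sub>2 \<and>
    ((\<exists>z \<in> poles C. z \<noteq> 0 \<and> (Fin z \<in> frontier A\<^sub>1 \<or> Fin z \<in> frontier A\<^sub>2)) \<longrightarrow>
      connected (julia_set C))"
proof -
  interpret qc: quartic_chebyshev b
    by standard (use assms in auto)
  have C: "C = qc.C"
    by (simp add: C_def qc.C_def qc.p_def)
  have A: "A\<^sub>1 = immediate_basin qc.C (Fin (qc.root 1))" "A\<^sub>2 = immediate_basin qc.C (Fin (qc.root (- 1)))"
    by (simp_all add: A\<^sub>1_def A\<^sub>2_def C qc.root_def)
  have "connected (julia_set C)"
    if "z \<in> poles C" "z \<noteq> 0" "Fin z \<in> frontier A\<^sub>1 \<or> Fin z \<in> frontier A\<^sub>2" for z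
  proof -
    have "poly qc.Q z = 0"
      using that(1) by (auto simp: poles_def C qc.C_Fin split: if_splits)
    then show ?thesis
      using that(2,3) qc.connected_julia_set[of 1 z] qc.connected_julia_set[of "- 1" z]
      by (auto simp: C A frontier_def)
  qed
  then show ?thesis
    using qc.simply_connected_immediate_basin[of 1] qc.simply_connected_immediate_basin[of "- 1"]
    by (auto simp: A)
qed

end
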